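(* Let $(M,\mathcal{T})$ be a triangulated closed 3-manifold with $N$ vertices. For any initial data $\pmb{r}(0)\in\mathbb{R}^N_+$, there exists a solution $\pmb{r}(t)\in\mathbb{R}^N_+$ to the extended combinatorial Yamabe flow $$\frac{dr_i}{dt}=-\widetilde{K}_i\sinh r_i,\qquad i\in\mathcal{T}_0,$$ which exists for all $t\in[0,\infty)$.
   Context: $M$ is a closed 3-manifold with a (finite) triangulation $\mathcal{T}=\{\mathcal{T}_0,\mathcal{T}_1,\mathcal{T}_2,\mathcal{T}_3\}$ (vertices, edges, faces, tetrahedra), $\mathcal{T}_0=\{1,\dots,N\}$; $\{ijkl\}\in\mathcal{T}_3$ denotes the tetrahedron with vertices $i,j,k,l$. $\mathbb{R}_+=(0,\infty)$. A (hyperbolic) ball packing is a vector $\pmb{r}=(r_1,\dots,r_N)\in\mathbb{R}^N_+$. For $(r_i,r_j,r_k,r_l)\in\mathbb{R}_+^4$ write $y_a=\coth r_a$ and $Q=(y_i+y_j+y_k+y_l)^2-2(y_i^2+y_j^2+y_k^2+y_l^2)+4$. A non-degenerate tetrahedron in $\mathbb{H}^3$ (curvature $-1$) with edge lengths $l_{ab}=r_a+r_b$ exists iff $Q>0$ and is then unique up to isometry; $\alpha_{ijkl}$ is then its solid angle at $i$ (sum of the three dihedral angles at the edges through $i$, minus $\pi$). The set $\{Q\le 0\}\subset\mathbb{R}_+^4$ is the disjoint union of the four sets $D_a$, $a\in\{i,j,k,l\}$, where $D_a=\{y_a\geq y_b+y_c+y_d+2(y_by_c+y_cy_d+y_dy_b+1)^{1/2}\}$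 with $\{a,b,c,d\}=\{i,j,k,l\}$. The extended solid angle at $i$ is $\widetilde\alpha_{ijkl}=\alpha_{ijkl}$ if $Q>0$, $\widetilde\alpha_{ijkl}=2\pi$ on $D_i$, and $\widetilde\alpha_{ijkl}=0$ on $D_j\cup D_k\cup D_l$. The extended combinatorial scalar curvature is $\widetilde{K}_i=4\pi-\sum\widetilde{\alpha}_{ijkl}$, summed over all tetrahedra incident to $i$; in the flow it is evaluated at $\pmb r(t)$. *)

theory Defs
  imports "HOL-Analysis.Analysis"
begin

section \<open>Triangulated closed manifolds\<close>

definition closed_manifold :: "nat \<Rightarrow> 'a topology \<Rightarrow> bool" where
  "closed_manifold n M \<longleftrightarrow>
     compact_space M \<and> Hausdorff_space M \<and> second_countable M \<and>
     (\<forall>x\<in>topspace M. \<exists>U V. openin M U \<and> x \<in> U \<and> openin (Euclidean_space n) V \<and>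
        subtopology M U homeomorphic_space subtopology (Euclidean_space n) V)"

definition simplicial_complex :: "'v set set \<Rightarrow> bool" where
  "simplicial_complex T \<longleftrightarrow>
     (\<forall>\<sigma>\<in>T. finite \<sigma> \<and> \<sigma> \<noteq> {}) \<and> (\<forall>\<sigma>\<in>T. \<forall>\<tau>. \<tau> \<noteq> {} \<and> \<tau> \<subseteq> \<sigma> \<longrightarrow> \<tau> \<in> T)"

definition simplices :: "'v set set \<Rightarrow> nat \<Rightarrow> 'v set set" where
  "simplices T n = {\<sigma>\<in>T. card \<sigma> = Suc n}"

text \<open>Points are given by their barycentric coordinates. For a finite complex, the only case
  used below, the subspace topology inherited from the product is the usual (weak) one.\<close>
definition geometric_realization :: "'v set set \<Rightarrow> ('v \<Rightarrow> real) topology" where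
  "geometric_realization T =
     subtopology (powertop_real UNIV)
       {x. (\<forall>v. 0 \<le> x v) \<and> {v. x v \<noteq> 0} \<in> T \<and> (\<Sum>v\<in>{v. x v \<noteq> 0}. x v) = 1}"

definition triangulated_closed_3_manifold :: "'a topology \<Rightarrow> nat set set \<Rightarrow> nat \<Rightarrow> bool" where
  "triangulated_closed_3_manifold M T N \<longleftrightarrow>
     closed_manifold 3 M \<and>
     finite T \<and> simplicial_complex T \<and> T = (\<Union>n\<le>3. simplices T n) \<and> \<Union>T = {1..N} \<and>
     geometric_realization T homeomorphic_space M"

section \<open>Hyperbolic tetrahedra\<close>

type_synonym minkowski = "real \<times> (real ^ 3)"

text \<open>Hyperbolic 3-space is the upper sheet of the hyperboloid; the first component is the
  timelike coordinate.\<close>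
definition lorentz :: "minkowski \<Rightarrow> minkowski \<Rightarrow> real" where
  "lorentz p q = snd p \<bullet> snd q - fst p * fst q"

definition hyp3 :: "minkowski set" where
  "hyp3 = {p. lorentz p p = -1 \<and> 0 < fst p}"

definition hyp_dist :: "minkowski \<Rightarrow> minkowski \<Rightarrow> real" where
  "hyp_dist p q = arcosh (- lorentz p q)"

text \<open>The hyperbolic planes are the sets \<open>{x \<in> hyp3. lorentz n x = 0}\<close> with \<open>n\<close> spacelike.\<close>
definition nondegenerate_tetrahedron ::
    "minkowski \<Rightarrow> minkowski \<Rightarrow> minkowski \<Rightarrow> minkowski \<Rightarrow> bool" where
  "nondegenerate_tetrahedron p q s t \<longleftrightarrow>
     {p, q, s, t} \<subseteq> hyp3 \<and> \<not> (\<exists>n. 0 < lorentz n n \<and> (\<forall>x\<in>{p, q, s, t}. lorentz n x = 0))"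

text \<open>A positive multiple of the initial velocity of the geodesic from \<open>p\<close> to \<open>q\<close>: the orthogonal
  projection of \<open>q\<close> to the tangent space of \<open>hyp3\<close> at \<open>p\<close>.\<close>
definition hyp_direction :: "minkowski \<Rightarrow> minkowski \<Rightarrow> minkowski" where
  "hyp_direction p q = q + lorentz p q *\<^sub>R p"

definition lorentz_reject :: "minkowski \<Rightarrow> minkowski \<Rightarrow> minkowski" where
  "lorentz_reject e u = u - (lorentz u e / lorentz e e) *\<^sub>R e"

definition lorentz_angle :: "minkowski \<Rightarrow> minkowski \<Rightarrow> real" where
  "lorentz_angle u w = arccos (lorentz u w / (sqrt (lorentz u u) * sqrt (lorentz w w)))"

text \<open>The angle, at \<open>p\<close>, between the two vectors that are tangent to the faces \<open>pqs\<close> and \<open>pqt\<close>,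
  orthogonal to their common edge \<open>pq\<close> and point into the faces.\<close>
definition dihedral_angle :: "minkowski \<Rightarrow> minkowski \<Rightarrow> minkowski \<Rightarrow> minkowski \<Rightarrow> real" where
  "dihedral_angle p q s t =
     lorentz_angle (lorentz_reject (hyp_direction p q) (hyp_direction p s))
                   (lorentz_reject (hyp_direction p q) (hyp_direction p t))"

definition vertex_solid_angle :: "minkowski \<Rightarrow> minkowski \<Rightarrow> minkowski \<Rightarrow> minkowski \<Rightarrow> real" where
  "vertex_solid_angle p q s t =
     dihedral_angle p q s t + dihedral_angle p s t q + dihedral_angle p t q s - pi"

section \<open>Ball packings and the extended curvature\<close>

definition coth :: "real \<Rightarrow> real" where
  "coth x = cosh x / sinh x"

definition packing_Q :: "real \<Rightarrow> real \<Rightarrow> real \<Rightarrow> real \<Rightarrow> real" where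
  "packing_Q a b c d =
     (coth a + coth b + coth c + coth d)\<^sup>2
       - 2 * ((coth a)\<^sup>2 + (coth b)\<^sup>2 + (coth c)\<^sup>2 + (coth d)\<^sup>2) + 4"

definition packing_tetrahedron ::
    "real \<Rightarrow> real \<Rightarrow> real \<Rightarrow> real \<Rightarrow> minkowski \<Rightarrow> minkowski \<Rightarrow> minkowski \<Rightarrow> minkowski \<Rightarrow> bool" where
  "packing_tetrahedron a b c d p q s t \<longleftrightarrow>
     nondegenerate_tetrahedron p q s t \<and>
     hyp_dist p q = a + b \<and> hyp_dist p s = a + c \<and> hyp_dist p t = a + d \<and>
     hyp_dist q s = b + c \<and> hyp_dist q t = b + d \<and> hyp_dist s t = c + d"

text \<open>The tetrahedron exists iff \<open>packing_Q a b c d > 0\<close>; it is then unique up to isometry, so that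
  the choice does not matter.\<close>
definition packing_solid_angle :: "real \<Rightarrow> real \<Rightarrow> real \<Rightarrow> real \<Rightarrow> real" where
  "packing_solid_angle a b c d =
     (SOME \<alpha>. \<exists>p q s t. packing_tetrahedron a b c d p q s t \<and> \<alpha> = vertex_solid_angle p q s t)"

text \<open>The part of \<open>packing_Q \<le> 0\<close> that belongs to the first radius. For positive radii the region
  \<open>packing_Q \<le> 0\<close> is the disjoint union of the four sets obtained by exchanging the roles of the
  radii.\<close>
definition virtual_region :: "real \<Rightarrow> real \<Rightarrow> real \<Rightarrow> real \<Rightarrow> bool" where
  "virtual_region a b c d \<longleftrightarrow>
     coth a \<ge> coth b + coth c + coth d
       + 2 * sqrt (coth b * coth c + coth c * coth d + coth d * coth b + 1)"

text \<open>Both solid angles are taken at the vertex of the first radius and are symmetric in the other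
  three.\<close>
definition ext_solid_angle :: "real \<Rightarrow> real \<Rightarrow> real \<Rightarrow> real \<Rightarrow> real" where
  "ext_solid_angle a b c d =
     (if packing_Q a b c d > 0 then packing_solid_angle a b c d
      else if virtual_region a b c d then 2 * pi
      else 0)"

text \<open>Ordering the remaining vertices makes every tetrahedron at \<open>i\<close> occur exactly once.\<close>
definition ext_scalar_curvature :: "nat set set \<Rightarrow> (nat \<Rightarrow> real) \<Rightarrow> nat \<Rightarrow> real" where
  "ext_scalar_curvature T r i =
     4 * pi - (\<Sum>(j, k, l)\<in>{(j, k, l). j < k \<and> k < l \<and> {i, j, k, l} \<in> simplices T 3}.
                 ext_solid_angle (r i) (r j) (r k) (r l))"

end

theory Submission
  imports Defs
begin

text \<open>In the coordinates \<open>y = coth r\<close> the dihedral angle of a packing tetrahedron at an edge is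
  the angle of a Euclidean triangle with explicit side lengths, and \<open>packing_Q > 0\<close> says exactly
  that this triangle exists. Clamping its cosine to \<open>[-1, 1]\<close> therefore extends the angle
  continuously, and on the virtual regions the clamped angles are \<open>0\<close> or \<open>\<pi>\<close>, so that their sum
  minus \<open>\<pi>\<close> is the extended solid angle everywhere.

  With \<open>v = ln (tanh (r / 2)) < 0\<close> one has \<open>coth r = cosh v\<close>, and the flow becomes \<open>v' = - K\<close>
  with a continuous bounded right-hand side; radii cannot reach \<open>0\<close>, which is \<open>v = -\<infinity>\<close>. To keep
  \<open>v\<close> away from \<open>0\<close>, note that the solid angle at a vertex tends to \<open>0\<close> uniformly in the other
  radii as its own radius tends to infinity: the link of the vertex shrinks to a Euclidean
  triangle. Hence \<open>K > 0\<close> for \<open>v\<close> close to \<open>0\<close>, and truncating \<open>v\<close> at such a level gives a vector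
  field on the whole space to which Peano's theorem applies, and whose solutions never exceed the
  level.\<close>

section \<open>Peano existence in a product of lines\<close>

lemma tendsto_coordinatewise:
  fixes f :: "'a \<Rightarrow> 'i \<Rightarrow> 'b::topological_space"
  shows "(f \<longlongrightarrow> l) F \<longleftrightarrow> (\<forall>i. ((\<lambda>x. f x i) \<longlongrightarrow> l i) F)"
  using limitin_componentwise[of "\<lambda>_. euclidean" UNIV f l F]
  by (simp add: euclidean_product_topology)

text \<open>Tychonoff makes the box compact. The index set may be uncountable, as it is when time is
  part of the index, so a convergent subsequence need not exist; a proper filter finer than
  \<open>sequentially\<close> takes its place.\<close>

lemma bounded_sequence_convergent_along_filter:
  fixes X :: "nat \<Rightarrow> 'i \<Rightarrow> real"
  assumes "\<And>n i. \<bar>X n i - c i\<bar> \<le> B i"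
  obtains H x where "H \<noteq> bot" "H \<le> sequentially" "\<And>i. ((\<lambda>n. X n i) \<longlongrightarrow> x i) H"
proof -
  let ?K = "Pi\<^sub>E UNIV (\<lambda>i. cball (c i) (B i))"
  have "compactin (product_topology (\<lambda>i. euclidean) UNIV) ?K"
    by (simp add: compactin_PiE)
  then have K: "compact ?K" by (simp add: euclidean_product_topology)
  have "eventually (\<lambda>x. x \<in> ?K) (filtermap X sequentially)"
    unfolding eventually_filtermap using assms
    by (intro always_eventually) (auto simp: dist_real_def abs_minus_commute)
  moreover have "filtermap X sequentially \<noteq> bot" by (simp add: filtermap_bot_iff)
  ultimately obtain x where x: "inf (nhds x) (filtermap X sequentially) \<noteq> bot"
    using K unfolding compact_filter by blast
  \<comment> \<open>Generated by tails of the sequence met with preimages of neighbourhoods of the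
    cluster point \<open>x\<close>; it is proper because \<open>x\<close> is a cluster
    point.\<close>
  define H where "H = inf sequentially (filtercomap X (nhds x))"
  have "H \<noteq> bot"
  proof
    assume "H = bot"
    then have "eventually (\<lambda>_. False) H" by simp
    then obtain P Q where P: "eventually P sequentially" and Q: "eventually Q (filtercomap X (nhds x))"
      and PQ: "\<And>n. P n \<Longrightarrow> Q n \<Longrightarrow> False"
      unfolding H_def eventually_inf by blast
    obtain R where R: "eventually R (nhds x)" "\<And>n. R (X n) \<Longrightarrow> Q n"
      using Q unfolding eventually_filtercomap by blast
    have "eventually (\<lambda>y. \<not> R y) (filtermap X sequentially)"
      unfolding eventually_filtermap using P by eventually_elim (use PQ R in blast)
    with R(1) have "eventually (\<lambda>_. False) (inf (nhds x) (filtermap X sequentially))"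
      unfolding eventually_inf by blast
    with x show False by (simp add: eventually_False)
  qed
  moreover have "H \<le> sequentially" by (simp add: H_def)
  moreover have "filterlim X (nhds x) H"
    unfolding H_def by (rule filterlim_mono[OF filterlim_filtercomap]) auto
  ultimately show thesis using that[of H x] by (simp add: tendsto_coordinatewise)
qed

section \<open>Euler approximations and their increments\<close>

primrec euler_iterate :: "real \<Rightarrow> (('i \<Rightarrow> real) \<Rightarrow> 'i \<Rightarrow> real) \<Rightarrow> ('i \<Rightarrow> real) \<Rightarrow> nat \<Rightarrow> 'i \<Rightarrow> real" where
  "euler_iterate h F x0 0 = x0"
| "euler_iterate h F x0 (Suc k) = (\<lambda>i. euler_iterate h F x0 k i + h * F (euler_iterate h F x0 k) i)"

text \<open>Each step deviates from the constant drift \<open>L\<close> by at most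
  \<open>h * e\<close>, and the \<open>k - m\<close> deviations add up.\<close>

lemma euler_iterate_increment:
  assumes "m \<le> k" "0 \<le> h" "\<And>l. m \<le> l \<Longrightarrow> l < k \<Longrightarrow> \<bar>F (euler_iterate h F x0 l) i - L\<bar> \<le> e"
  shows "\<bar>euler_iterate h F x0 k i - euler_iterate h F x0 m i - (real k - real m) * h * L\<bar>
           \<le> (real k - real m) * h * e"
  using assms(1,3)
proof (induction k rule: dec_induct)
  case base then show ?case by simp
next
  case (step k)
  let ?z = "euler_iterate h F x0"
  have "h * \<bar>F (?z k) i - L\<bar> \<le> h * e" using step assms by (intro mult_left_mono) auto
  then have "\<bar>h * (F (?z k) i - L)\<bar> \<le> h * e" using assms by (simp add: abs_mult)
  moreover have "\<bar>?z k i - ?z m i - (real k - real m) * h * L\<bar> \<le> (real k - real m) * h * e"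
    using step by simp
  moreover have "?z (Suc k) i - ?z m i - (real (Suc k) - real m) * h * L
      = (?z k i - ?z m i - (real k - real m) * h * L) + h * (F (?z k) i - L)"
    by (simp add: algebra_simps)
  moreover have "(real (Suc k) - real m) * h * e = (real k - real m) * h * e + h * e"
    by (simp add: algebra_simps)
  ultimately show ?case by linarith
qed

text \<open>Piecewise constant instead of the usual polygon: values are always grid iterates, at the
  price of jumps that vanish with \<open>h\<close>.\<close>

definition euler_step_function ::
    "real \<Rightarrow> (('i \<Rightarrow> real) \<Rightarrow> 'i \<Rightarrow> real) \<Rightarrow> ('i \<Rightarrow> real) \<Rightarrow> real \<Rightarrow> 'i \<Rightarrow> real" where
  "euler_step_function h F x0 t = euler_iterate h F x0 (nat \<lfloor>t / h\<rfloor>)"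

text \<open>Rounding \<open>s\<close> and \<open>t\<close> down to the grid changes the elapsed time
  by at most \<open>h\<close>, which costs the terms \<open>h * e\<close> and
  \<open>h * \<bar>L\<bar>\<close>. The assumption on \<open>F\<close> reaches back to
  \<open>s - h\<close> because the grid point of \<open>s\<close> may lie before
  \<open>s\<close>.\<close>

lemma euler_step_function_increment:
  assumes h: "0 < h" and st: "0 \<le> s" "s \<le> t" and e: "0 \<le> e"
    and F: "\<And>u. s - h < u \<Longrightarrow> u \<le> t \<Longrightarrow> 0 \<le> u \<Longrightarrow> \<bar>F (euler_step_function h F x0 u) i - L\<bar> \<le> e"
  shows "\<bar>euler_step_function h F x0 t i - euler_step_function h F x0 s i - (t - s) * L\<bar>
           \<le> (t - s + h) * e + h * \<bar>L\<bar>"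
proof -
  define m k where "m = nat \<lfloor>s / h\<rfloor>" and "k = nat \<lfloor>t / h\<rfloor>"
  have rm: "real m \<le> s / h" "s / h < real m + 1" and rk: "real k \<le> t / h" "t / h < real k + 1"
    using h st unfolding m_def k_def by (auto simp: of_nat_nat)
  have mh: "real m * h \<le> s" "s < real m * h + h" and kh: "real k * h \<le> t" "t < real k * h + h"
    using rm rk h by (auto simp: field_simps)
  have mk: "m \<le> k" unfolding m_def k_def using h st by (intro nat_mono floor_mono divide_right_mono) auto
  have grid: "\<bar>F (euler_iterate h F x0 l) i - L\<bar> \<le> e" if "m \<le> l" "l < k" for l
  proof -
    have "0 \<le> real l * h" "real m * h \<le> real l * h" "real l * h \<le> real k * h"
      using that h by (auto intro!: mult_right_mono)
    then have "\<bar>F (euler_step_function h F x0 (real l * h)) i - L\<bar> \<le> e"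
      using mh kh h by (intro F) linarith+
    then show ?thesis using h by (simp add: euler_step_function_def)
  qed
  define d where "d = (real k - real m) * h"
  have d: "\<bar>d - (t - s)\<bar> \<le> h" "0 \<le> d"
    using mh kh mk h unfolding d_def by (auto simp: algebra_simps abs_le_iff mult_right_mono)
  have "\<bar>euler_step_function h F x0 t i - euler_step_function h F x0 s i - d * L\<bar> \<le> d * e"
    using euler_iterate_increment[of m k h F x0 i L e] mk h grid
    unfolding euler_step_function_def m_def[symmetric] k_def[symmetric] d_def by auto
  moreover have "d * e \<le> (t - s + h) * e" using d e by (intro mult_right_mono) auto
  moreover have "\<bar>d * L - (t - s) * L\<bar> \<le> h * \<bar>L\<bar>"
    using d by (simp add: abs_mult mult_right_mono flip: left_diff_distrib)
  ultimately show ?thesis by linarith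
qed

text \<open>A limit of Euler step functions is taken for all times and coordinates at once, and the
  derivative is read off from the increment estimate without an integral equation. The bound on
  \<open>F\<close> is global, so the solution exists for all times without continuation; it may
  depend on the coordinate.\<close>

theorem peano_existence:
  fixes F :: "('i \<Rightarrow> real) \<Rightarrow> 'i \<Rightarrow> real"
  assumes cont: "\<And>i. continuous_on UNIV (\<lambda>x. F x i)" and bound: "\<And>x i. \<bar>F x i\<bar> \<le> C i"
  obtains x :: "real \<Rightarrow> 'i \<Rightarrow> real" where "x 0 = x0"
    "\<And>t i. 0 \<le> t \<Longrightarrow> ((\<lambda>s. x s i) has_real_derivative F (x t) i) (at t within {0..})"
proof -
  define h where "h n = inverse (real (Suc n))" for n
  have h: "0 < h n" "h n \<le> 1" for n unfolding h_def by (auto simp: field_simps)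
  have h0: "h \<longlonglongrightarrow> 0" unfolding h_def by (rule LIMSEQ_inverse_real_of_nat)
  define X where "X n = euler_step_function (h n) F x0" for n
  have C: "0 \<le> C i" for i using bound[of undefined i] by linarith
  \<comment> \<open>Comparison with zero drift: a Lipschitz estimate up to one step.\<close>
  have lip: "\<bar>X n t i - X n s i\<bar> \<le> (\<bar>t - s\<bar> + h n) * C i" if "0 \<le> s" "0 \<le> t" for n s t i
    using that
  proof (induction s t rule: linorder_wlog)
    case (le s t)
    then show ?case
      using euler_step_function_increment[of "h n" s t "C i" F x0 i 0] h[of n] C[of i] bound
      by (simp add: X_def)
  next
    case (sym s t) then show ?case by (simp add: abs_minus_commute)
  qed
  have X0: "X n 0 = x0" for n by (simp add: X_def euler_step_function_def)
  \<comment> \<open>The compactness lemma wants a bound at every index \<open>(t, i)\<close>,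
    negative \<open>t\<close> included; \<open>max 0 t\<close> freezes those times at the initial
    value.\<close>
  have "\<bar>X n (max 0 t) i - x0 i\<bar> \<le> (\<bar>t\<bar> + 1) * C i" for n t i
  proof -
    have "(\<bar>max 0 t\<bar> + h n) * C i \<le> (\<bar>t\<bar> + 1) * C i" using h[of n] C by (intro mult_right_mono) auto
    then show ?thesis using lip[of 0 "max 0 t" n i] by (simp add: X0)
  qed
  then obtain H y where H: "H \<noteq> bot" "H \<le> sequentially"
    and y: "\<And>ti. ((\<lambda>n. X n (max 0 (fst ti)) (snd ti)) \<longlongrightarrow> y ti) H"
    using bounded_sequence_convergent_along_filter
      [of "\<lambda>n ti. X n (max 0 (fst ti)) (snd ti)" "\<lambda>ti. x0 (snd ti)" "\<lambda>ti. (\<bar>fst ti\<bar> + 1) * C (snd ti)"]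
    by metis
  define x where "x t i = y (t, i)" for t i
  have lim: "((\<lambda>n. X n t i) \<longlongrightarrow> x t i) H" if "0 \<le> t" for t i
    using y[of "(t, i)"] that by (simp add: x_def)
  have hH: "(h \<longlongrightarrow> 0) H" using h0 H(2) by (rule tendsto_mono[rotated])
  show thesis
  proof
    have "x 0 i = x0 i" for i
    proof -
      have "((\<lambda>_. x0 i) \<longlongrightarrow> x 0 i) H" using lim[of 0 i] by (simp add: X0)
      then show ?thesis using H(1) by (simp add: tendsto_const_iff)
    qed
    then show "x 0 = x0" by auto
  next
    fix t :: real and i assume t: "0 \<le> t"
    let ?L = "F (x t) i"
    text \<open>Equicontinuity up to the step size turns convergence at \<open>t\<close> into convergence near \<open>t\<close>.\<close>
    have "((\<lambda>p. X (fst p) (snd p)) \<longlongrightarrow> x t) (H \<times>\<^sub>F inf (nhds t) (principal {0..}))"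
      unfolding tendsto_coordinatewise
    proof
      fix j
      let ?G = "H \<times>\<^sub>F inf (nhds t) (principal {0..})"
      have fst: "filterlim fst H ?G" and snd: "filterlim snd (inf (nhds t) (principal {0..})) ?G"
        by (simp_all add: filterlim_fst filterlim_snd)
      have "(snd \<longlongrightarrow> t) ?G" and ev: "eventually (\<lambda>p. snd p \<in> {0..}) ?G"
        using snd unfolding filterlim_inf filterlim_principal by auto
      then have "((\<lambda>p. (\<bar>snd p - t\<bar> + h (fst p)) * C j + \<bar>X (fst p) t j - x t j\<bar>)
          \<longlongrightarrow> (\<bar>t - t\<bar> + 0) * C j + \<bar>x t j - x t j\<bar>) ?G"
        by (intro tendsto_intros filterlim_compose[OF hH fst] filterlim_compose[OF lim[OF t] fst])
      then have 0: "((\<lambda>p. (\<bar>snd p - t\<bar> + h (fst p)) * C j + \<bar>X (fst p) t j - x t j\<bar>) \<longlongrightarrow> 0) ?G"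
        by simp
      have "eventually (\<lambda>p. norm (X (fst p) (snd p) j - x t j)
          \<le> (\<bar>snd p - t\<bar> + h (fst p)) * C j + \<bar>X (fst p) t j - x t j\<bar>) ?G"
        using ev
      proof eventually_elim
        case (elim p)
        then show ?case using lip[of t "snd p" "fst p" j] t by simp
      qed
      then have "((\<lambda>p. X (fst p) (snd p) j - x t j) \<longlongrightarrow> 0) ?G" by (rule Lim_null_comparison[OF _ 0])
      then show "((\<lambda>p. X (fst p) (snd p) j) \<longlongrightarrow> x t j) ?G" by (rule LIM_zero_cancel)
    qed
    then have FX: "((\<lambda>p. F (X (fst p) (snd p)) i) \<longlongrightarrow> ?L) (H \<times>\<^sub>F inf (nhds t) (principal {0..}))"
      using continuous_on_tendsto_compose[OF cont[of i], of _ "x t"] by simp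
    show "((\<lambda>s. x s i) has_real_derivative ?L) (at t within {0..})"
      unfolding has_field_derivative_iff tendsto_iff
    proof (intro allI impI)
      fix e :: real assume e: "0 < e"
      \<comment> \<open>Passing to the limit only yields non-strict bounds; halving restores the
        strict one.\<close>
      define e' where "e' = e / 2"
      have e': "0 < e'" "e' < e" using e by (auto simp: e'_def)
      have "eventually (\<lambda>p. dist (F (X (fst p) (snd p)) i) ?L < e') (H \<times>\<^sub>F inf (nhds t) (principal {0..}))"
        using FX e' by (simp add: tendsto_iff)
      then obtain P Q where P: "eventually P H" and Q: "eventually Q (inf (nhds t) (principal {0..}))"
        and PQ: "\<And>n s. P n \<Longrightarrow> Q s \<Longrightarrow> dist (F (X n s) i) ?L < e'"
        unfolding eventually_prod_filter by auto
      from Q obtain d where d: "0 < d" "\<And>s. \<bar>s - t\<bar> < d \<Longrightarrow> 0 \<le> s \<Longrightarrow> Q s"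
        unfolding eventually_inf_principal eventually_nhds_metric by (auto simp: dist_real_def)
      \<comment> \<open>Limit of the increment estimate along \<open>H\<close>. The radius
        \<open>d / 2\<close> leaves room for the look-back by \<open>h n < d / 2\<close>, so all
        times involved stay within \<open>d\<close> of \<open>t\<close>.\<close>
      have near: "\<bar>x v i - x u i - (v - u) * ?L\<bar> \<le> (v - u) * e'"
        if uv: "0 \<le> u" "u \<le> v" "\<bar>u - t\<bar> < d / 2" "\<bar>v - t\<bar> < d / 2" for u v
      proof (rule tendsto_le[OF H(1)])
        show "((\<lambda>n. (v - u + h n) * e' + h n * \<bar>?L\<bar>) \<longlongrightarrow> (v - u) * e') H"
          by (rule tendsto_eq_intros hH refl | simp)+
        show "((\<lambda>n. \<bar>X n v i - X n u i - (v - u) * ?L\<bar>) \<longlongrightarrow> \<bar>x v i - x u i - (v - u) * ?L\<bar>) H"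
          using uv by (intro tendsto_intros lim) auto
        have "eventually (\<lambda>n. h n < d / 2) H" using order_tendstoD(2)[OF hH, of "d / 2"] d by simp
        then show "eventually (\<lambda>n. \<bar>X n v i - X n u i - (v - u) * ?L\<bar> \<le> (v - u + h n) * e' + h n * \<bar>?L\<bar>) H"
          using P
        proof eventually_elim
          case (elim n)
          show ?case unfolding X_def
          proof (rule euler_step_function_increment)
            fix w assume w: "u - h n < w" "w \<le> v" "0 \<le> w"
            have "\<bar>w - t\<bar> < d" using w uv elim by linarith
            then have "Q w" using w by (intro d)
            then show "\<bar>F (euler_step_function (h n) F x0 w) i - ?L\<bar> \<le> e'"
              using PQ[OF elim(2), of w] by (simp add: X_def dist_real_def)
          qed (use uv h e' in auto)
        qed
      qed
      have "dist ((x s i - x t i) / (s - t)) ?L < e"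
        if s: "0 \<le> s" "s \<noteq> t" "\<bar>s - t\<bar> < d / 2" for s
      proof -
        have "\<bar>x s i - x t i - (s - t) * ?L\<bar> \<le> \<bar>s - t\<bar> * e'"
        proof (cases "t \<le> s")
          case True then show ?thesis using near[of t s] s t d by simp
        next
          case False
          then have "\<bar>x t i - x s i - (t - s) * ?L\<bar> \<le> (t - s) * e'" using near[of s t] s t d by simp
          moreover have "x s i - x t i - (s - t) * ?L = - (x t i - x s i - (t - s) * ?L)"
            by (simp add: algebra_simps)
          ultimately show ?thesis using False by (simp only: abs_minus_cancel) simp
        qed
        moreover have "(x s i - x t i) / (s - t) - ?L = (x s i - x t i - (s - t) * ?L) / (s - t)"
          using s by (simp add: field_simps)
        ultimately have "\<bar>(x s i - x t i) / (s - t) - ?L\<bar> \<le> e'"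
          using s by (simp add: abs_divide divide_le_eq mult.commute)
        then show ?thesis using e' by (simp add: dist_real_def)
      qed
      then show "eventually (\<lambda>s. dist ((x s i - x t i) / (s - t)) ?L < e) (at t within {0..})"
        unfolding eventually_at using d by (intro exI[of _ "d / 2"]) (auto simp: dist_real_def)
    qed
  qed
qed

section \<open>Extended angles in hyperbolic cotangents\<close>

text \<open>For hyperbolic cotangents of radii x, y, z this is sinh (x + y + z) / (sinh x sinh y
  sinh z), the squared hyperbolic cotangent of the inradius of the face with these radii.\<close>

definition coth_sigma :: "real \<Rightarrow> real \<Rightarrow> real \<Rightarrow> real" where
  "coth_sigma a b c = a * b + b * c + c * a + 1"

definition coth_Q :: "real \<Rightarrow> real \<Rightarrow> real \<Rightarrow> real \<Rightarrow> real" where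
  "coth_Q a b c d = (a + b + c + d)\<^sup>2 - 2 * (a\<^sup>2 + b\<^sup>2 + c\<^sup>2 + d\<^sup>2) + 4"

text \<open>Euclidean law of cosines: sides \<open>sqrt (coth_sigma a b c)\<close> and
  \<open>sqrt (coth_sigma a b d)\<close> enclose the angle, and \<open>a + b\<close> is opposite to
  it.\<close>

definition edge_cos :: "real \<Rightarrow> real \<Rightarrow> real \<Rightarrow> real \<Rightarrow> real" where
  "edge_cos a b c d =
     (coth_sigma a b c + coth_sigma a b d - (a + b)\<^sup>2) / (2 * sqrt (coth_sigma a b c * coth_sigma a b d))"

definition clamped_arccos :: "real \<Rightarrow> real" where
  "clamped_arccos x = arccos (max (- 1) (min 1 x))"

definition coth_solid_angle :: "real \<Rightarrow> real \<Rightarrow> real \<Rightarrow> real \<Rightarrow> real" where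
  "coth_solid_angle a b c d =
     clamped_arccos (edge_cos a b c d) + clamped_arccos (edge_cos a c d b)
       + clamped_arccos (edge_cos a d b c) - pi"

lemma clamped_arccos_ge_1: "1 \<le> x \<Longrightarrow> clamped_arccos x = 0"
  by (simp add: clamped_arccos_def)

lemma clamped_arccos_le_minus_1: "x \<le> - 1 \<Longrightarrow> clamped_arccos x = pi"
  by (simp add: clamped_arccos_def)

lemma clamped_arccos_eq: "\<bar>x\<bar> \<le> 1 \<Longrightarrow> clamped_arccos x = arccos x"
  by (simp add: clamped_arccos_def abs_le_iff)

lemma clamped_arccos_bounds: "0 \<le> clamped_arccos x" "clamped_arccos x \<le> pi"
  unfolding clamped_arccos_def by (intro arccos_lbound arccos_ubound; simp)+

lemma continuous_on_clamped_arccos [continuous_intros]: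
  "continuous_on S f \<Longrightarrow> continuous_on S (\<lambda>x. clamped_arccos (f x))"
  unfolding clamped_arccos_def by (intro continuous_intros) auto

lemma coth_sigma_pos: "0 < a \<Longrightarrow> 0 < b \<Longrightarrow> 0 < c \<Longrightarrow> 0 < coth_sigma a b c"
  unfolding coth_sigma_def by (intro add_pos_pos mult_pos_pos) auto

lemma coth_solid_angle_bounds: "\<bar>coth_solid_angle a b c d\<bar> \<le> 2 * pi"
  using clamped_arccos_bounds[of "edge_cos a b c d"] clamped_arccos_bounds[of "edge_cos a c d b"]
    clamped_arccos_bounds[of "edge_cos a d b c"]
  by (simp add: coth_solid_angle_def abs_le_iff)

lemma continuous_on_coth_solid_angle [continuous_intros]:
  assumes "continuous_on S f" "continuous_on S g" "continuous_on S h" "continuous_on S k"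
    and "\<And>x. x \<in> S \<Longrightarrow> 0 < f x" "\<And>x. x \<in> S \<Longrightarrow> 0 < g x" "\<And>x. x \<in> S \<Longrightarrow> 0 < h x" "\<And>x. x \<in> S \<Longrightarrow> 0 < k x"
  shows "continuous_on S (\<lambda>x. coth_solid_angle (f x) (g x) (h x) (k x))"
proof -
  have edge: "continuous_on S (\<lambda>x. edge_cos (p x) (q x) (u x) (v x))"
    if "continuous_on S p" "continuous_on S q" "continuous_on S u" "continuous_on S v"
      "\<And>x. x \<in> S \<Longrightarrow> 0 < p x \<and> 0 < q x \<and> 0 < u x \<and> 0 < v x" for p q u v
  proof -
    have "2 * sqrt (coth_sigma (p x) (q x) (u x) * coth_sigma (p x) (q x) (v x)) \<noteq> 0" if "x \<in> S" for x
      using that \<open>\<And>x. x \<in> S \<Longrightarrow> 0 < p x \<and> 0 < q x \<and> 0 < u x \<and> 0 < v x\<close>[of x]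
        coth_sigma_pos[of "p x" "q x" "u x"] coth_sigma_pos[of "p x" "q x" "v x"] by simp
    moreover have "continuous_on S (\<lambda>x. coth_sigma (p x) (q x) (u x))"
      "continuous_on S (\<lambda>x. coth_sigma (p x) (q x) (v x))"
      unfolding coth_sigma_def by (intro continuous_intros that)+
    ultimately show ?thesis
      unfolding edge_cos_def using that by (intro continuous_intros) auto
  qed
  show ?thesis
    unfolding coth_solid_angle_def using assms by (intro continuous_intros edge) auto
qed

text \<open>Heron's formula: the left side is 16 times the squared area of the triangle behind
  \<open>edge_cos\<close>. Since \<open>coth_Q\<close> is symmetric, its sign decides for all edges
  at once whether their triangles exist.\<close>

lemma edge_cos_discriminant:
  "4 * (coth_sigma a b c * coth_sigma a b d) - (coth_sigma a b c + coth_sigma a b d - (a + b)\<^sup>2)\<^sup>2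
     = (a + b)\<^sup>2 * coth_Q a b c d"
  unfolding coth_sigma_def coth_Q_def by (simp add: power2_eq_square algebra_simps)

lemma abs_edge_cos_less_1:
  assumes "0 < a" "0 < b" "0 < c" "0 < d" "0 < coth_Q a b c d"
  shows "\<bar>edge_cos a b c d\<bar> < 1"
proof -
  let ?P = "coth_sigma a b c * coth_sigma a b d"
  have P: "0 < ?P" using assms by (simp add: coth_sigma_pos)
  have "0 < (a + b)\<^sup>2 * coth_Q a b c d" using assms by simp
  then have "\<bar>coth_sigma a b c + coth_sigma a b d - (a + b)\<^sup>2\<bar>\<^sup>2 < (2 * sqrt ?P)\<^sup>2"
    using P edge_cos_discriminant[of a b c d] by (simp add: power_mult_distrib)
  then have "\<bar>coth_sigma a b c + coth_sigma a b d - (a + b)\<^sup>2\<bar> < 2 * sqrt ?P"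
    by (rule power2_less_imp_less) (use P in simp)
  then show ?thesis unfolding edge_cos_def using P by (simp add: abs_divide abs_mult)
qed

text \<open>A nonpositive discriminant makes the numerator at least as large in absolute value as
  the denominator, so its sign alone decides between the two clamped values.\<close>

lemma edge_cos_degenerate:
  assumes "0 < a" "0 < b" "0 < c" "0 < d" "coth_Q a b c d \<le> 0"
  shows "(a + b)\<^sup>2 \<le> coth_sigma a b c + coth_sigma a b d \<Longrightarrow> 1 \<le> edge_cos a b c d"
    and "coth_sigma a b c + coth_sigma a b d \<le> (a + b)\<^sup>2 \<Longrightarrow> edge_cos a b c d \<le> - 1"
proof -
  let ?P = "coth_sigma a b c * coth_sigma a b d" and ?n = "coth_sigma a b c + coth_sigma a b d - (a + b)\<^sup>2"
  have P: "0 < ?P" using assms by (simp add: coth_sigma_pos)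
  have "(a + b)\<^sup>2 * coth_Q a b c d \<le> 0" using assms by (simp add: mult_nonneg_nonpos)
  then have "(2 * sqrt ?P)\<^sup>2 \<le> \<bar>?n\<bar>\<^sup>2"
    using P edge_cos_discriminant[of a b c d] by (simp add: power_mult_distrib)
  then have n: "2 * sqrt ?P \<le> \<bar>?n\<bar>" by (rule power2_le_imp_le) simp
  have sqrt_pos: "0 < 2 * sqrt ?P" using P by simp
  show "1 \<le> edge_cos a b c d" if "(a + b)\<^sup>2 \<le> coth_sigma a b c + coth_sigma a b d"
    using n that sqrt_pos unfolding edge_cos_def by (subst pos_le_divide_eq) auto
  show "edge_cos a b c d \<le> - 1" if "coth_sigma a b c + coth_sigma a b d \<le> (a + b)\<^sup>2"
    using n that sqrt_pos unfolding edge_cos_def by (subst pos_divide_le_eq) auto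
qed

section \<open>Clamped angles on the virtual regions\<close>

lemma edge_cos_commute: "edge_cos a b c d = edge_cos a b d c"
  unfolding edge_cos_def by (simp add: add.commute mult.commute)

text \<open>A very large cotangent means a tiny ball in the gap between the other three. The
  flattened tetrahedron has angle pi at the three edges through that vertex and 0 at the others;
  this lemma and its two companions cover the possible positions of the vertex relative to the edge
  \<open>ab\<close>.\<close>

lemma edge_cos_virtual_own:
  assumes "0 < b" "0 < c" "0 < d" "coth_Q a b c d \<le> 0" "b + c + d + 2 \<le> a"
  shows "edge_cos a b c d \<le> - 1"
proof (rule edge_cos_degenerate(2))
  have "a * (c + d) + 2 * a \<le> a * (a - b)" using assms mult_left_mono[of "c + d + 2" "a - b" a]
    by (simp add: algebra_simps)
  moreover have "b * (c + d) \<le> b * a" using assms by (intro mult_left_mono) auto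
  ultimately have "a * c + a * d + b * c + b * d + 2 \<le> a * a"
    using assms by (simp add: algebra_simps)
  also have "\<dots> \<le> a * a + b * b" by simp
  finally show "coth_sigma a b c + coth_sigma a b d \<le> (a + b)\<^sup>2"
    unfolding coth_sigma_def power2_eq_square by (simp add: algebra_simps)
qed (use assms in auto)

lemma edge_cos_virtual_adjacent:
  assumes "0 < a" "0 < c" "0 < d" "coth_Q a b c d \<le> 0" "a + c + d + 2 \<le> b"
  shows "edge_cos a b c d \<le> - 1"
proof -
  have "coth_Q b a c d \<le> 0" using assms by (simp add: coth_Q_def algebra_simps)
  then have "edge_cos b a c d \<le> - 1" using assms edge_cos_virtual_own[of a c d b] by simp
  moreover have "edge_cos b a c d = edge_cos a b c d"
    by (simp add: edge_cos_def coth_sigma_def add.commute add.left_commute mult.commute)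
  ultimately show ?thesis by simp
qed

lemma edge_cos_virtual_opposite:
  assumes "0 < a" "0 < b" "0 < d" "coth_Q a b c d \<le> 0" "a + b + d + 2 \<le> c"
  shows "1 \<le> edge_cos a b c d"
proof (rule edge_cos_degenerate(1))
  have "(a + b) * (a + b) \<le> (a + b) * (c + d)" using assms by (intro mult_left_mono) auto
  moreover have "0 \<le> a * b" using assms by simp
  ultimately show "(a + b)\<^sup>2 \<le> coth_sigma a b c + coth_sigma a b d"
    unfolding coth_sigma_def power2_eq_square by (simp add: algebra_simps)
qed (use assms in auto)

text \<open>As a quadratic in \<open>a\<close>, \<open>coth_Q a b c d\<close> equals
  \<open>4 * coth_sigma b c d - (a - (b + c + d))\<^sup>2\<close>, so being nonpositive puts
  \<open>a\<close> outside the two roots. Below the smaller root \<open>a\<close> could not be the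
  maximum.\<close>

lemma virtual_if_max:
  assumes "0 < a" "0 < b" "0 < c" "0 < d" "coth_Q a b c d \<le> 0" "b \<le> a" "c \<le> a" "d \<le> a"
  shows "b + c + d + 2 * sqrt (coth_sigma b c d) \<le> a"
proof -
  have pos: "0 < coth_sigma b c d" using assms by (simp add: coth_sigma_pos)
  have "(2 * sqrt (coth_sigma b c d))\<^sup>2 \<le> \<bar>a - (b + c + d)\<bar>\<^sup>2"
    using assms(5) pos unfolding coth_Q_def power_mult_distrib
    by (simp add: power2_eq_square) (simp add: coth_sigma_def algebra_simps)
  then have le: "2 * sqrt (coth_sigma b c d) \<le> \<bar>a - (b + c + d)\<bar>" by (rule power2_le_imp_le) simp
  \<comment> \<open>With \<open>z\<close> the largest of the three, this puts the smaller root below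
    \<open>z\<close>, contradicting that \<open>a\<close> is at least \<open>z\<close>.\<close>
  have two: "x + y < 2 * sqrt (coth_sigma b c d)"
    if "0 < x" "0 < y" "x \<le> z" "y \<le> z" "coth_sigma b c d = coth_sigma x y z" for x y z
  proof (rule power2_less_imp_less)
    have "x * x \<le> x * z" "y * y \<le> y * z" "0 < x * y" "0 < x * x" "0 < y * y"
      using that by (auto intro: mult_left_mono)
    then have "(x + y)\<^sup>2 < 4 * coth_sigma x y z"
      unfolding coth_sigma_def power2_eq_square by (simp add: algebra_simps)
    then show "(x + y)\<^sup>2 < (2 * sqrt (coth_sigma b c d))\<^sup>2"
      using pos that by (simp add: power_mult_distrib)
  qed (use pos in simp)
  have "\<not> a \<le> b + c + d - 2 * sqrt (coth_sigma b c d)"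
  proof -
    consider "b \<le> d" "c \<le> d" | "b \<le> c" "d \<le> c" | "c \<le> b" "d \<le> b" by linarith
    then show ?thesis
    proof cases
      case 1 then show ?thesis using two[of b c d] assms by simp
    next
      case 2 then show ?thesis using two[of b d c] assms by (simp add: coth_sigma_def algebra_simps)
    next
      case 3 then show ?thesis using two[of c d b] assms by (simp add: coth_sigma_def algebra_simps)
    qed
  qed
  then show ?thesis using le by linarith
qed

lemma coth_gt_1: "0 < r \<Longrightarrow> 1 < coth r"
  unfolding coth_def by (subst less_divide_eq_1_pos) (auto simp: sinh_less_cosh_real)

lemma coth_pos: "0 < r \<Longrightarrow> 0 < coth r"
  using coth_gt_1[of r] by simp

lemma packing_Q_eq: "packing_Q a b c d = coth_Q (coth a) (coth b) (coth c) (coth d)"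
  by (simp add: packing_Q_def coth_Q_def)

lemma ext_solid_angle_degenerate:
  assumes "0 < a" "0 < b" "0 < c" "0 < d" "packing_Q a b c d \<le> 0"
  shows "ext_solid_angle a b c d = coth_solid_angle (coth a) (coth b) (coth c) (coth d)"
proof -
  define y1 y2 y3 y4 where y: "y1 = coth a" "y2 = coth b" "y3 = coth c" "y4 = coth d"
  have pos: "0 < y1" "0 < y2" "0 < y3" "0 < y4" using assms by (simp_all add: y coth_pos)
  have Q: "coth_Q y1 y2 y3 y4 \<le> 0" using assms by (simp add: packing_Q_eq y)
  then have Qs: "coth_Q y1 y3 y4 y2 \<le> 0" "coth_Q y1 y4 y2 y3 \<le> 0"
    "coth_Q y1 y2 y4 y3 \<le> 0" "coth_Q y1 y3 y2 y4 \<le> 0" "coth_Q y1 y4 y3 y2 \<le> 0"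
    "coth_Q y2 y1 y3 y4 \<le> 0" "coth_Q y3 y1 y2 y4 \<le> 0" "coth_Q y4 y1 y2 y3 \<le> 0"
    by (simp_all add: coth_Q_def algebra_simps)
  \<comment> \<open>Each \<open>coth_sigma\<close> is at least 1, which is the source of the summand
    2 in the virtual edge lemmas.\<close>
  have sqrt: "2 \<le> 2 * sqrt (coth_sigma u v w)" if "0 < u" "0 < v" "0 < w" for u v w
    using that by (simp add: coth_sigma_def add_increasing)
  show ?thesis
  proof (cases "virtual_region a b c d")
    case True
    then have "y2 + y3 + y4 + 2 * sqrt (coth_sigma y2 y3 y4) \<le> y1"
      by (simp add: virtual_region_def y coth_sigma_def algebra_simps)
    then have "y2 + y3 + y4 + 2 \<le> y1" using sqrt[of y2 y3 y4] pos by linarith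
    then have "coth_solid_angle y1 y2 y3 y4 = 2 * pi"
      unfolding coth_solid_angle_def using pos Q Qs
        edge_cos_virtual_own[of y2 y3 y4 y1] edge_cos_virtual_own[of y3 y4 y2 y1]
        edge_cos_virtual_own[of y4 y2 y3 y1]
      by (simp add: clamped_arccos_le_minus_1)
    then show ?thesis using True assms by (simp add: ext_solid_angle_def y)
  next
    case False
    then have "\<not> y2 + y3 + y4 + 2 * sqrt (coth_sigma y2 y3 y4) \<le> y1"
      by (simp add: virtual_region_def y coth_sigma_def algebra_simps)
    \<comment> \<open>So the maximum is attained at another vertex, whose virtual region applies:
      one edge angle is pi, the other two are 0, and the angular excess vanishes.\<close>
    then have "\<not> (y2 \<le> y1 \<and> y3 \<le> y1 \<and> y4 \<le> y1)" using virtual_if_max pos Q by blast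
    then consider "y1 \<le> y2" "y3 \<le> y2" "y4 \<le> y2" | "y1 \<le> y3" "y2 \<le> y3" "y4 \<le> y3"
      | "y1 \<le> y4" "y2 \<le> y4" "y3 \<le> y4" by linarith
    then have "coth_solid_angle y1 y2 y3 y4 = 0"
    proof cases
      case 1
      then have big: "y1 + y3 + y4 + 2 \<le> y2"
        using virtual_if_max[of y2 y1 y3 y4] sqrt[of y1 y3 y4] pos Qs by linarith
      have "edge_cos y1 y2 y3 y4 \<le> - 1"
        by (rule edge_cos_virtual_adjacent) (use pos Q Qs big in linarith)+
      moreover have "1 \<le> edge_cos y1 y3 y4 y2"
        unfolding edge_cos_commute[of y1 y3 y4 y2]
        by (rule edge_cos_virtual_opposite) (use pos Q Qs big in linarith)+
      moreover have "1 \<le> edge_cos y1 y4 y2 y3"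
        by (rule edge_cos_virtual_opposite) (use pos Q Qs big in linarith)+
      ultimately show ?thesis
        by (simp add: coth_solid_angle_def clamped_arccos_le_minus_1 clamped_arccos_ge_1)
    next
      case 2
      then have big: "y1 + y2 + y4 + 2 \<le> y3"
        using virtual_if_max[of y3 y1 y2 y4] sqrt[of y1 y2 y4] pos Qs by linarith
      have "edge_cos y1 y3 y4 y2 \<le> - 1"
        by (rule edge_cos_virtual_adjacent) (use pos Q Qs big in linarith)+
      moreover have "1 \<le> edge_cos y1 y4 y2 y3"
        unfolding edge_cos_commute[of y1 y4 y2 y3]
        by (rule edge_cos_virtual_opposite) (use pos Q Qs big in linarith)+
      moreover have "1 \<le> edge_cos y1 y2 y3 y4"
        by (rule edge_cos_virtual_opposite) (use pos Q Qs big in linarith)+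
      ultimately show ?thesis
        by (simp add: coth_solid_angle_def clamped_arccos_le_minus_1 clamped_arccos_ge_1)
    next
      case 3
      then have big: "y1 + y2 + y3 + 2 \<le> y4"
        using virtual_if_max[of y4 y1 y2 y3] sqrt[of y1 y2 y3] pos Qs by linarith
      have "edge_cos y1 y4 y2 y3 \<le> - 1"
        by (rule edge_cos_virtual_adjacent) (use pos Q Qs big in linarith)+
      moreover have "1 \<le> edge_cos y1 y2 y3 y4"
        unfolding edge_cos_commute[of y1 y2 y3 y4]
        by (rule edge_cos_virtual_opposite) (use pos Q Qs big in linarith)+
      moreover have "1 \<le> edge_cos y1 y3 y4 y2"
        by (rule edge_cos_virtual_opposite) (use pos Q Qs big in linarith)+
      ultimately show ?thesis
        by (simp add: coth_solid_angle_def clamped_arccos_le_minus_1 clamped_arccos_ge_1)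
    qed
    then show ?thesis using False assms by (simp add: ext_solid_angle_def y)
  qed
qed

section \<open>Solid angles of packing tetrahedra\<close>

lemma lorentz_commute: "lorentz p q = lorentz q p"
  by (simp add: lorentz_def inner_commute mult.commute)

lemma lorentz_bilinear:
  "lorentz (p + q) s = lorentz p s + lorentz q s" "lorentz p (q + s) = lorentz p q + lorentz p s"
  "lorentz (p - q) s = lorentz p s - lorentz q s" "lorentz p (q - s) = lorentz p q - lorentz p s"
  "lorentz (x *\<^sub>R p) s = x * lorentz p s" "lorentz p (x *\<^sub>R s) = x * lorentz p s"
  by (simp_all add: lorentz_def inner_add_left inner_add_right inner_diff_left inner_diff_right algebra_simps)

text \<open>Reverse Cauchy-Schwarz on the hyperboloid; it places the argument of
  \<open>arcosh\<close> in the range where \<open>cosh\<close> undoes it.\<close>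

lemma lorentz_hyp3_le:
  assumes "p \<in> hyp3" "q \<in> hyp3"
  shows "lorentz p q \<le> - 1"
proof -
  let ?x = "norm (snd p)" and ?y = "norm (snd q)"
  have p: "fst p * fst p = 1 + ?x\<^sup>2" "0 < fst p" and q: "fst q * fst q = 1 + ?y\<^sup>2" "0 < fst q"
    using assms by (auto simp: hyp3_def lorentz_def power2_norm_eq_inner)
  have "(fst p * fst q)\<^sup>2 = (fst p * fst p) * (fst q * fst q)"
    by (simp add: power2_eq_square mult_ac)
  then have "(fst p * fst q)\<^sup>2 = (1 + ?x\<^sup>2) * (1 + ?y\<^sup>2)"
    unfolding p(1) q(1) .
  moreover have "(1 + ?x * ?y)\<^sup>2 + (?x - ?y)\<^sup>2 = (1 + ?x\<^sup>2) * (1 + ?y\<^sup>2)"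
    by (simp add: power2_eq_square algebra_simps)
  moreover have "0 \<le> (?x - ?y)\<^sup>2" by simp
  ultimately have "(1 + ?x * ?y)\<^sup>2 \<le> (fst p * fst q)\<^sup>2" by linarith
  then have "1 + ?x * ?y \<le> fst p * fst q" by (rule power2_le_imp_le) (use p q in simp)
  then show ?thesis using norm_cauchy_schwarz[of "snd p" "snd q"] by (simp add: lorentz_def)
qed

lemma lorentz_eq_of_hyp_dist:
  assumes "p \<in> hyp3" "q \<in> hyp3" "hyp_dist p q = d"
  shows "lorentz p q = - cosh d"
  using assms lorentz_hyp3_le[of p q] cosh_arcosh_real[of "- lorentz p q"] by (simp add: hyp_dist_def)

lemma lorentz_hyp_direction:
  "lorentz p p = - 1 \<Longrightarrow>
     lorentz (hyp_direction p q) (hyp_direction p s) = lorentz q s + lorentz p q * lorentz p s"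
  by (simp add: hyp_direction_def lorentz_bilinear lorentz_commute[of q p] algebra_simps)

lemma lorentz_reject_reject:
  "lorentz e e \<noteq> 0 \<Longrightarrow>
     lorentz (lorentz_reject e u) (lorentz_reject e w) = lorentz u w - lorentz u e * lorentz w e / lorentz e e"
  by (simp add: lorentz_reject_def lorentz_bilinear lorentz_commute[of e w] lorentz_commute[of e u] field_simps)

section \<open>Face angles and the link of a vertex\<close>

text \<open>The cosine of the angle at the vertex of radius \<open>a\<close> in the triangle of the radii \<open>a\<close>, \<open>b\<close>
  and \<open>c\<close>. In this form the hyperbolic law of cosines needs no triangle inequality.\<close>
definition face_cos :: "real \<Rightarrow> real \<Rightarrow> real \<Rightarrow> real" where
  "face_cos a b c = 1 - 2 * sinh b * sinh c / (sinh (a + b) * sinh (a + c))"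

lemma face_cos_law:
  fixes a b c :: real
  assumes "0 < a" "0 < b" "0 < c"
  shows "sinh (a + b) * sinh (a + c) * face_cos a b c = cosh (a + b) * cosh (a + c) - cosh (b + c)"
proof -
  have "sinh (a + b) * sinh (a + c) * face_cos a b c = sinh (a + b) * sinh (a + c) - 2 * sinh b * sinh c"
    using assms by (simp add: face_cos_def right_diff_distrib less_imp_neq[symmetric])
  moreover have "cosh (a + b) * cosh (a + c) - sinh (a + b) * sinh (a + c) = cosh (b - c)"
    using cosh_diff[of "a + b" "a + c"] by simp
  ultimately show ?thesis by (simp add: cosh_diff cosh_add)
qed

lemma sinh_add_coth:
  fixes a b :: real
  assumes "0 < a" "0 < b"
  shows "sinh (a + b) = sinh a * sinh b * (coth a + coth b)"
  using assms by (simp add: coth_def sinh_add field_simps)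

lemma face_cos_coth:
  assumes "0 < a" "0 < b" "0 < c"
  shows "face_cos a b c = 1 - 2 * ((coth a)\<^sup>2 - 1) / ((coth a + coth b) * (coth a + coth c))"
proof -
  have sa: "0 < sinh a" "0 < sinh b" "0 < sinh c" using assms by auto
  define X Y where XY: "X = coth a + coth b" "Y = coth a + coth c"
  have pos: "0 < X" "0 < Y" using assms by (simp_all add: XY coth_pos add_pos_pos)
  have K: "(coth a)\<^sup>2 - 1 = 1 / (sinh a * sinh a)"
    using sa hyperbolic_pythagoras[of a] by (simp add: coth_def field_simps power2_eq_square)
  have "sinh (a + b) = sinh a * sinh b * X" "sinh (a + c) = sinh a * sinh c * Y"
    using assms by (simp_all add: sinh_add_coth XY)
  then show ?thesis using sa pos unfolding face_cos_def K XY[symmetric] by simp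
qed

text \<open>With \<open>K = (coth a)\<^sup>2 - 1\<close>, \<open>face_cos\<close> is
  \<open>1 - 2 * K / (X * Y)\<close> and \<open>coth_sigma\<close> is \<open>X * Y - K\<close>, so
  the factors of the difference of squares are explicit. All are positive, so every face angle lies
  strictly between 0 and pi.\<close>

lemma one_minus_face_cos_square:
  assumes "0 < a" "0 < b" "0 < c"
  shows "1 - (face_cos a b c)\<^sup>2 = 4 * ((coth a)\<^sup>2 - 1) * coth_sigma (coth a) (coth b) (coth c)
           / ((coth a + coth b) * (coth a + coth c))\<^sup>2"
proof -
  define X Y K where XY: "X = coth a + coth b" "Y = coth a + coth c" and K: "K = (coth a)\<^sup>2 - 1"
  have "0 < X" "0 < Y" using assms by (simp_all add: XY coth_pos add_pos_pos)
  have sigma: "coth_sigma (coth a) (coth b) (coth c) = X * Y - K"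
    by (simp add: coth_sigma_def XY K power2_eq_square algebra_simps)
  show ?thesis unfolding face_cos_coth[OF assms] XY[symmetric] K[symmetric] sigma
    using \<open>0 < X\<close> \<open>0 < Y\<close> by (simp add: field_simps power2_eq_square)
qed

lemma face_cos_square_less_1:
  assumes "0 < a" "0 < b" "0 < c"
  shows "(face_cos a b c)\<^sup>2 < 1"
proof -
  have y: "1 < coth a" "1 < coth b" "1 < coth c" using assms coth_gt_1 by auto
  then have "0 < 4 * ((coth a)\<^sup>2 - 1) * coth_sigma (coth a) (coth b) (coth c)
           / ((coth a + coth b) * (coth a + coth c))\<^sup>2"
    by (intro divide_pos_pos mult_pos_pos coth_sigma_pos) (auto simp: one_less_power)
  then show ?thesis using one_minus_face_cos_square[OF assms] by linarith
qed

text \<open>The spherical law of cosines in the link of the vertex of radius \<open>a\<close>.\<close>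
lemma face_cos_edge_cos:
  assumes "0 < a" "0 < b" "0 < c" "0 < d"
  shows "(face_cos a c d - face_cos a b c * face_cos a b d)
           / (sqrt (1 - (face_cos a b c)\<^sup>2) * sqrt (1 - (face_cos a b d)\<^sup>2))
         = edge_cos (coth a) (coth b) (coth c) (coth d)"
proof -
  define S xb xc xd where x: "S = (coth a)\<^sup>2 - 1" "xb = coth a + coth b" "xc = coth a + coth c" "xd = coth a + coth d"
  define P R where P: "P = coth_sigma (coth a) (coth b) (coth c)" and R: "R = coth_sigma (coth a) (coth b) (coth d)"
  have y: "1 < coth a" "1 < coth b" "1 < coth c" "1 < coth d" using assms coth_gt_1 by auto
  have pos: "0 < S" "0 < xb" "0 < xc" "0 < xd" "0 < P" "0 < R"
    using y by (auto simp: x P R one_less_power intro!: coth_sigma_pos)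
  have PR: "P = xb * xc - S" "R = xb * xd - S"
    unfolding x P R coth_sigma_def by (simp_all add: power2_eq_square algebra_simps)
  have "sqrt (1 - (face_cos a b c)\<^sup>2) = 2 * sqrt S * sqrt P / (xb * xc)"
    using pos one_minus_face_cos_square[OF assms(1-3)] unfolding x(1)[symmetric] x(2)[symmetric] x(3)[symmetric] P[symmetric]
    by (simp add: real_sqrt_divide real_sqrt_mult)
  moreover have "sqrt (1 - (face_cos a b d)\<^sup>2) = 2 * sqrt S * sqrt R / (xb * xd)"
    using pos one_minus_face_cos_square[OF assms(1,2,4)] unfolding x(1)[symmetric] x(2)[symmetric] x(4)[symmetric] R[symmetric]
    by (simp add: real_sqrt_divide real_sqrt_mult)
  ultimately have "sqrt (1 - (face_cos a b c)\<^sup>2) * sqrt (1 - (face_cos a b d)\<^sup>2)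
      = (2 * (sqrt S * sqrt S) / (xb * xb * xc * xd)) * (2 * (sqrt P * sqrt R))"
    by (simp add: mult_ac)
  then have den: "sqrt (1 - (face_cos a b c)\<^sup>2) * sqrt (1 - (face_cos a b d)\<^sup>2)
      = (2 * S / (xb * xb * xc * xd)) * (2 * sqrt (P * R))"
    using pos by (simp add: real_sqrt_mult)
  \<comment> \<open>The prefactor is the one split off from the denominator in \<open>den\<close>;
    it cancels and leaves the Euclidean law of cosines.\<close>
  have "face_cos a c d - face_cos a b c * face_cos a b d
      = (2 * S / (xb * xb * xc * xd)) * (xb * xc + xb * xd - xb * xb - 2 * S)"
    using pos assms unfolding face_cos_coth[OF assms(1,3,4)] face_cos_coth[OF assms(1,2,3)] face_cos_coth[OF assms(1,2,4)] x[symmetric]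
    by (simp add: field_simps)
  moreover have "xb * xc + xb * xd - xb * xb - 2 * S = P + R - xb\<^sup>2"
    by (simp add: PR power2_eq_square)
  ultimately have num: "face_cos a c d - face_cos a b c * face_cos a b d
      = (2 * S / (xb * xb * xc * xd)) * (P + R - xb\<^sup>2)" by simp
  have "2 * S / (xb * xb * xc * xd) \<noteq> 0" using pos by simp
  then show ?thesis unfolding num den edge_cos_def P[symmetric] R[symmetric] x(2)[symmetric]
    by (rule mult_divide_mult_cancel_left)
qed

text \<open>The dihedral angle is an angle of the spherical link at \<open>p\<close>. The initial
  directions have lengths \<open>A\<close>, \<open>C\<close>, \<open>D\<close> and mutual cosines
  \<open>face_cos\<close>; after projecting away the edge direction the lengths cancel and the
  spherical law of cosines remains.\<close>

lemma dihedral_angle_packing: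
  assumes r: "0 < a" "0 < b" "0 < c" "0 < d"
    and self: "lorentz p p = - 1" "lorentz q q = - 1" "lorentz s s = - 1" "lorentz t t = - 1"
    and p: "lorentz p q = - cosh (a + b)" "lorentz p s = - cosh (a + c)" "lorentz p t = - cosh (a + d)"
    and o: "lorentz q s = - cosh (b + c)" "lorentz q t = - cosh (b + d)" "lorentz s t = - cosh (c + d)"
  shows "dihedral_angle p q s t = arccos (edge_cos (coth a) (coth b) (coth c) (coth d))"
proof -
  define A C D where ACD: "A = sinh (a + b)" "C = sinh (a + c)" "D = sinh (a + d)"
  have pos: "0 < A" "0 < C" "0 < D" using r by (auto simp: ACD)
  let ?u = "hyp_direction p"
  have u: "lorentz (?u q) (?u q) = A * A" "lorentz (?u s) (?u s) = C * C" "lorentz (?u t) (?u t) = D * D"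
    using hyperbolic_pythagoras[of "a + b"] hyperbolic_pythagoras[of "a + c"] hyperbolic_pythagoras[of "a + d"]
    by (simp_all add: lorentz_hyp_direction self p ACD power2_eq_square)
  have f: "lorentz (?u q) (?u s) = A * C * face_cos a b c" "lorentz (?u q) (?u t) = A * D * face_cos a b d"
    "lorentz (?u s) (?u t) = C * D * face_cos a c d"
    using face_cos_law r by (simp_all add: lorentz_hyp_direction self p o ACD)
  let ?s = "lorentz_reject (?u q) (?u s)" and ?t = "lorentz_reject (?u q) (?u t)"
  have rej: "lorentz ?s ?s = C\<^sup>2 * (1 - (face_cos a b c)\<^sup>2)" "lorentz ?t ?t = D\<^sup>2 * (1 - (face_cos a b d)\<^sup>2)"
    "lorentz ?s ?t = C * D * (face_cos a c d - face_cos a b c * face_cos a b d)"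
    using pos by (simp_all add: lorentz_reject_reject u f lorentz_commute[of "?u s" "?u q"]
        lorentz_commute[of "?u t" "?u q"] field_simps power2_eq_square)
  have "lorentz ?s ?t / (sqrt (lorentz ?s ?s) * sqrt (lorentz ?t ?t))
      = (C * D) * (face_cos a c d - face_cos a b c * face_cos a b d)
         / ((C * D) * (sqrt (1 - (face_cos a b c)\<^sup>2) * sqrt (1 - (face_cos a b d)\<^sup>2)))"
    using pos by (simp add: rej real_sqrt_mult mult_ac)
  also have "\<dots> = edge_cos (coth a) (coth b) (coth c) (coth d)"
    using pos face_cos_edge_cos[OF r] by simp
  finally show ?thesis by (simp add: dihedral_angle_def lorentz_angle_def)
qed

text \<open>The right side does not depend on the chosen points, which makes the choice in
  \<open>packing_solid_angle\<close> harmless. As \<open>packing_Q\<close> is positive, no clamping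
  takes effect.\<close>

lemma vertex_solid_angle_packing:
  assumes r: "0 < a" "0 < b" "0 < c" "0 < d" and Q: "0 < packing_Q a b c d"
    and tet: "packing_tetrahedron a b c d p q s t"
  shows "vertex_solid_angle p q s t = coth_solid_angle (coth a) (coth b) (coth c) (coth d)"
proof -
  have mem: "p \<in> hyp3" "q \<in> hyp3" "s \<in> hyp3" "t \<in> hyp3"
    using tet by (auto simp: packing_tetrahedron_def nondegenerate_tetrahedron_def)
  then have self: "lorentz p p = - 1" "lorentz q q = - 1" "lorentz s s = - 1" "lorentz t t = - 1"
    by (auto simp: hyp3_def)
  have dist: "lorentz p q = - cosh (a + b)" "lorentz p s = - cosh (a + c)" "lorentz p t = - cosh (a + d)"
    "lorentz q s = - cosh (b + c)" "lorentz q t = - cosh (b + d)" "lorentz s t = - cosh (c + d)"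
    using tet mem by (auto simp: packing_tetrahedron_def intro!: lorentz_eq_of_hyp_dist)
  have y: "0 < coth a" "0 < coth b" "0 < coth c" "0 < coth d" using r by (simp_all add: coth_pos)
  have Q1: "0 < coth_Q (coth a) (coth b) (coth c) (coth d)" using Q by (simp add: packing_Q_eq)
  then have Q2: "0 < coth_Q (coth a) (coth c) (coth d) (coth b)" and Q3: "0 < coth_Q (coth a) (coth d) (coth b) (coth c)"
    by (simp_all add: coth_Q_def algebra_simps)
  have "dihedral_angle p q s t = arccos (edge_cos (coth a) (coth b) (coth c) (coth d))"
    using r self dist by (intro dihedral_angle_packing)
  moreover have "dihedral_angle p s t q = arccos (edge_cos (coth a) (coth c) (coth d) (coth b))"
    using r self dist lorentz_commute[of s q] lorentz_commute[of t q]
    by (intro dihedral_angle_packing) (auto simp: add.commute)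
  moreover have "dihedral_angle p t q s = arccos (edge_cos (coth a) (coth d) (coth b) (coth c))"
    using r self dist lorentz_commute[of t s] lorentz_commute[of t q]
    by (intro dihedral_angle_packing) (auto simp: add.commute)
  ultimately show ?thesis
    using abs_edge_cos_less_1[OF y Q1] abs_edge_cos_less_1[OF y(1,3,4,2) Q2] abs_edge_cos_less_1[OF y(1,4,2,3) Q3]
    by (simp add: vertex_solid_angle_def coth_solid_angle_def clamped_arccos_eq less_imp_le)
qed

section \<open>Construction of packing tetrahedra\<close>

lemma unit_vectors_with_inner_products:
  fixes f g k :: real
  assumes f: "f\<^sup>2 < 1" and g: "g\<^sup>2 < 1"
    and k: "\<bar>(k - f * g) / (sqrt (1 - f\<^sup>2) * sqrt (1 - g\<^sup>2))\<bar> < 1"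
  obtains u v w :: "real ^ 3" where "u \<bullet> u = 1" "v \<bullet> v = 1" "w \<bullet> w = 1"
    "u \<bullet> v = f" "u \<bullet> w = g" "v \<bullet> w = k"
    "\<And>n. n \<bullet> u = 0 \<Longrightarrow> n \<bullet> v = 0 \<Longrightarrow> n \<bullet> w = 0 \<Longrightarrow> n = 0"
proof -
  define F G where FG: "F = sqrt (1 - f\<^sup>2)" "G = sqrt (1 - g\<^sup>2)"
  \<comment> \<open>The cosine of the angle between the projections of \<open>v\<close> and
    \<open>w\<close> orthogonal to \<open>u\<close>. Gram-Schmidt then dictates the coordinates
    below, and \<open>\<bar>e\<bar> < 1\<close> keeps the last one nonzero.\<close>
  define e where "e = (k - f * g) / (F * G)"
  define h where "h = sqrt (1 - e\<^sup>2)"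
  have e: "e\<^sup>2 < 1" using k by (simp add: e_def FG abs_square_less_1)
  have pos: "0 < F" "0 < G" "0 < h" using f g e by (auto simp: FG h_def)
  have sq: "F * F = 1 - f * f" "G * G = 1 - g * g" "h * h = 1 - e * e"
    using f g e by (simp_all add: FG h_def power2_eq_square)
  have ke: "F * (G * e) = k - f * g" using pos by (simp add: e_def)
  define u v w :: "real ^ 3" where uvw: "u = vector [1, 0, 0]" "v = vector [f, F, 0]" "w = vector [g, G * e, G * h]"
  have in3: "x \<bullet> y = x $ 1 * y $ 1 + x $ 2 * y $ 2 + x $ 3 * y $ 3" for x y :: "real ^ 3"
    by (simp add: inner_vec_def sum_3)
  have "w \<bullet> w = g * g + (G * G) * (e * e + h * h)"
    by (simp add: in3 uvw algebra_simps)
  then have "w \<bullet> w = 1" by (simp add: sq)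
  moreover have "n = 0" if n: "n \<bullet> u = 0" "n \<bullet> v = 0" "n \<bullet> w = 0" for n :: "real ^ 3"
  proof -
    have "n $ 1 = 0" using n(1) by (simp add: in3 uvw)
    moreover from this have "n $ 2 = 0" using n(2) pos by (simp add: in3 uvw)
    ultimately have "n $ 3 = 0" using n(3) pos by (simp add: in3 uvw)
    then show ?thesis using \<open>n $ 1 = 0\<close> \<open>n $ 2 = 0\<close> by (simp add: vec_eq_iff forall_3)
  qed
  ultimately show thesis
    using that[of u v w] by (simp add: in3 uvw sq ke)
qed

text \<open>One vertex is put at the base point of the hyperboloid, the others at the ends of
  geodesics of prescribed lengths leaving it at the face angles. The law of cosines supplies the
  three remaining lengths.\<close>

lemma packing_tetrahedron_exists:
  assumes r: "0 < a" "0 < b" "0 < c" "0 < d" and Q: "0 < packing_Q a b c d"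
  shows "\<exists>p q s t. packing_tetrahedron a b c d p q s t"
proof -
  have y: "0 < coth a" "0 < coth b" "0 < coth c" "0 < coth d" using r by (simp_all add: coth_pos)
  have "\<bar>(face_cos a c d - face_cos a b c * face_cos a b d)
           / (sqrt (1 - (face_cos a b c)\<^sup>2) * sqrt (1 - (face_cos a b d)\<^sup>2))\<bar> < 1"
    unfolding face_cos_edge_cos[OF r] using Q by (intro abs_edge_cos_less_1 y) (simp add: packing_Q_eq)
  from unit_vectors_with_inner_products[OF face_cos_square_less_1[OF r(1,2,3)] face_cos_square_less_1[OF r(1,2,4)] this]
  obtain u v w :: "real ^ 3" where unit: "u \<bullet> u = 1" "v \<bullet> v = 1" "w \<bullet> w = 1"
    and ip: "u \<bullet> v = face_cos a b c" "u \<bullet> w = face_cos a b d" "v \<bullet> w = face_cos a c d"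
    and indep: "\<And>n. n \<bullet> u = 0 \<Longrightarrow> n \<bullet> v = 0 \<Longrightarrow> n \<bullet> w = 0 \<Longrightarrow> n = 0"
    by metis
  define P :: "real \<Rightarrow> real ^ 3 \<Rightarrow> minkowski" where "P l e = (cosh l, sinh l *\<^sub>R e)" for l e
  let ?p = "(1, 0) :: minkowski" and ?q = "P (a + b) u" and ?s = "P (a + c) v" and ?t = "P (a + d) w"
  have self: "lorentz (P l e) (P l e) = - 1" if "e \<bullet> e = 1" for l e
    using hyperbolic_pythagoras[of l] that by (simp add: lorentz_def P_def power2_eq_square)
  have "P l e \<in> hyp3" if "e \<bullet> e = 1" for l e
    using self[OF that] by (simp add: hyp3_def P_def)
  then have mem: "{?p, ?q, ?s, ?t} \<subseteq> hyp3"
    using unit by (simp add: hyp3_def lorentz_def)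
  have "lorentz ?p (P l e) = - cosh l" for l e by (simp add: lorentz_def P_def)
  moreover have "lorentz ?q ?s = - cosh (b + c)" "lorentz ?q ?t = - cosh (b + d)" "lorentz ?s ?t = - cosh (c + d)"
    using face_cos_law[OF r(1,2,3)] face_cos_law[OF r(1,2,4)] face_cos_law[OF r(1,3,4)]
    by (simp_all add: lorentz_def P_def ip mult_ac)
  \<comment> \<open>Orthogonality to \<open>?p\<close> kills the time component; the rest is
    orthogonal to three independent directions, so the normal is 0 and not spacelike.\<close>
  moreover have "\<not> (\<exists>n. 0 < lorentz n n \<and> (\<forall>x\<in>{?p, ?q, ?s, ?t}. lorentz n x = 0))"
  proof clarify
    fix n1 :: real and n2 :: "real ^ 3"
    assume n: "0 < lorentz (n1, n2) (n1, n2)" and o: "\<forall>x\<in>{?p, ?q, ?s, ?t}. lorentz (n1, n2) x = 0"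
    have "n1 = 0" using o by (simp add: lorentz_def)
    moreover have "sinh (a + b) \<noteq> 0" "sinh (a + c) \<noteq> 0" "sinh (a + d) \<noteq> 0" using r by auto
    ultimately have "n2 = 0" using o by (intro indep) (auto simp: lorentz_def P_def)
    with \<open>n1 = 0\<close> n show False by (simp add: lorentz_def)
  qed
  ultimately have "packing_tetrahedron a b c d ?p ?q ?s ?t"
    using mem r by (simp add: packing_tetrahedron_def nondegenerate_tetrahedron_def hyp_dist_def arcosh_cosh_real)
  then show ?thesis by blast
qed

theorem ext_solid_angle_eq:
  assumes "0 < a" "0 < b" "0 < c" "0 < d"
  shows "ext_solid_angle a b c d = coth_solid_angle (coth a) (coth b) (coth c) (coth d)"
proof (cases "0 < packing_Q a b c d")
  case True
  obtain p q s t where "packing_tetrahedron a b c d p q s t"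
    using packing_tetrahedron_exists[OF assms True] by blast
  then have "\<exists>\<alpha> p q s t. packing_tetrahedron a b c d p q s t \<and> \<alpha> = vertex_solid_angle p q s t" by blast
  then have "\<exists>p q s t. packing_tetrahedron a b c d p q s t \<and> packing_solid_angle a b c d = vertex_solid_angle p q s t"
    unfolding packing_solid_angle_def by (rule someI_ex)
  then have "packing_solid_angle a b c d = coth_solid_angle (coth a) (coth b) (coth c) (coth d)"
    using vertex_solid_angle_packing[OF assms True] by metis
  then show ?thesis using True by (simp add: ext_solid_angle_def)
next
  case False then show ?thesis using ext_solid_angle_degenerate assms by simp
qed

section \<open>Vertices of large radius\<close>

definition side_cos :: "real \<Rightarrow> real \<Rightarrow> real \<Rightarrow> real" where
  "side_cos p q r = (q\<^sup>2 + r\<^sup>2 - p\<^sup>2) / (2 * q * r)"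

lemma side_cos_degenerate:
  assumes "0 < p" "0 < q" "0 < r" "q + r \<le> p"
  shows "side_cos p q r \<le> - 1" "1 \<le> side_cos q r p" "1 \<le> side_cos r p q"
proof -
  have "(q + r) * (q + r) \<le> p * p" "q * q \<le> (p - r) * (p - r)" "r * r \<le> (p - q) * (p - q)"
    using assms by (auto intro!: mult_mono)
  then show "side_cos p q r \<le> - 1" "1 \<le> side_cos q r p" "1 \<le> side_cos r p q"
    using assms by (simp_all add: side_cos_def divide_le_eq le_divide_eq) (simp_all add: power2_eq_square algebra_simps)
qed

lemma euclidean_triangle_angle_sum:
  assumes pos: "0 < p" "0 < q" "0 < r"
    and tri: "p < q + r" "q < r + p" "r < p + q"
  shows "arccos (side_cos p q r) + arccos (side_cos q r p) + arccos (side_cos r p q) = pi"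
    and "\<bar>side_cos p q r\<bar> < 1"
proof -
  have bound: "\<bar>side_cos x y z\<bar> < 1" if "0 < x" "0 < y" "0 < z" "x < y + z" "y < z + x" "z < x + y" for x y z
  proof -
    have "x\<^sup>2 < (y + z)\<^sup>2" using that by (intro power_strict_mono) auto
    moreover have "\<bar>y - z\<bar>\<^sup>2 < x\<^sup>2" using that by (intro power_strict_mono) auto
    ultimately have "\<bar>y\<^sup>2 + z\<^sup>2 - x\<^sup>2\<bar> < 2 * y * z"
      unfolding abs_less_iff power2_abs by (simp add: power2_eq_square algebra_simps)
    then show ?thesis using that by (simp add: side_cos_def abs_divide abs_mult)
  qed
  define x y z where xyz: "x = side_cos p q r" "y = side_cos q r p" "z = side_cos r p q"
  have x: "\<bar>x\<bar> < 1" and y: "\<bar>y\<bar> < 1" and z: "\<bar>z\<bar> < 1"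
    using bound[of p q r] bound[of q r p] bound[of r p q] pos tri by (simp_all add: xyz)
  have frac: "1 - (n / m)\<^sup>2 = (m\<^sup>2 - n\<^sup>2) / m\<^sup>2" if "0 < m" for n m :: real
    using that by (simp add: power_divide diff_divide_distrib)
  \<comment> \<open>16 times the squared area, hence the same at every vertex; the product of the
    two sines becomes rational in the sides.\<close>
  define D where "D = (2 * q * r)\<^sup>2 - (q\<^sup>2 + r\<^sup>2 - p\<^sup>2)\<^sup>2"
  have Dx: "1 - x\<^sup>2 = D / (2 * q * r)\<^sup>2"
    unfolding xyz side_cos_def D_def by (rule frac) (use pos in simp)
  have D': "D = (2 * r * p)\<^sup>2 - (r\<^sup>2 + p\<^sup>2 - q\<^sup>2)\<^sup>2"
    unfolding D_def by (simp add: power2_eq_square algebra_simps)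
  have Dy: "1 - y\<^sup>2 = D / (2 * r * p)\<^sup>2"
    unfolding xyz side_cos_def D' by (rule frac) (use pos in simp)
  have "0 < D / (2 * q * r)\<^sup>2" using x by (simp add: abs_square_less_1 flip: Dx)
  then have "0 < D" using pos by (simp add: zero_less_divide_iff)
  have "sqrt (1 - x\<^sup>2) = sqrt D / (2 * q * r)" "sqrt (1 - y\<^sup>2) = sqrt D / (2 * r * p)"
    using pos by (simp_all add: Dx Dy real_sqrt_divide)
  then have ss: "sqrt (1 - x\<^sup>2) * sqrt (1 - y\<^sup>2) = D / ((2 * q * r) * (2 * r * p))"
    using \<open>0 < D\<close> by simp
  have "cos (arccos x + arccos y) = x * y - sqrt (1 - x\<^sup>2) * sqrt (1 - y\<^sup>2)"
    using x y by (simp add: cos_add sin_arccos_abs)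
  also have "\<dots> = ((q\<^sup>2 + r\<^sup>2 - p\<^sup>2) * (r\<^sup>2 + p\<^sup>2 - q\<^sup>2) - D) / ((2 * q * r) * (2 * r * p))"
    unfolding ss by (simp only: xyz side_cos_def times_divide_times_eq diff_divide_distrib[symmetric])
  also have "(q\<^sup>2 + r\<^sup>2 - p\<^sup>2) * (r\<^sup>2 + p\<^sup>2 - q\<^sup>2) - D = - (p\<^sup>2 + q\<^sup>2 - r\<^sup>2) * (2 * r * r)"
    unfolding D_def by (simp add: power2_eq_square algebra_simps)
  also have "\<dots> / ((2 * q * r) * (2 * r * p)) = - z"
    using pos by (simp add: xyz side_cos_def field_simps)
  finally have cos_sum: "cos (arccos x + arccos y) = - z" .
  \<comment> \<open>A nonnegative sum of the cosines keeps the sum of the two angles within pi,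
    where its cosine determines it.\<close>
  have "0 \<le> (p + q) * (r\<^sup>2 - (p - q)\<^sup>2)"
  proof -
    have "\<bar>p - q\<bar>\<^sup>2 \<le> r\<^sup>2" using tri by (intro power_mono) auto
    then show ?thesis using pos by simp
  qed
  moreover have xy: "x + y = (p + q) * (r\<^sup>2 - (p - q)\<^sup>2) / (2 * p * q * r)"
    using pos by (simp add: xyz side_cos_def field_simps power2_eq_square)
  ultimately have "0 \<le> x + y" using pos unfolding xy by (intro divide_nonneg_nonneg) auto
  then have "arccos x \<le> arccos (- y)" using x y by (intro arccos_le_arccos) auto
  then have "arccos x + arccos y \<le> pi" using y by (simp add: arccos_minus)
  then have "arccos x + arccos y = arccos (- z)"
    using x y by (intro arccos_unique[symmetric] cos_sum) (auto intro!: add_nonneg_nonneg arccos_lbound)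
  then show "arccos (side_cos p q r) + arccos (side_cos q r p) + arccos (side_cos r p q) = pi"
    using z by (simp add: arccos_minus xyz)
  show "\<bar>side_cos p q r\<bar> < 1" using x by (simp add: xyz)
qed

text \<open>If the triangle inequality fails, the clamped angles are pi, 0, 0. The sum is thus pi
  for arbitrary positive sides, as a comparison uniform in the other radii requires.\<close>

lemma clamped_arccos_side_cos_sum:
  assumes "0 < p" "0 < q" "0 < r"
  shows "clamped_arccos (side_cos p q r) + clamped_arccos (side_cos q r p) + clamped_arccos (side_cos r p q) = pi"
proof -
  consider "q + r \<le> p" | "r + p \<le> q" | "p + q \<le> r" | "p < q + r" "q < r + p" "r < p + q" by linarith
  then show ?thesis
  proof cases
    case 1
    from side_cos_degenerate[OF assms 1] show ?thesis
      by (simp add: clamped_arccos_le_minus_1 clamped_arccos_ge_1)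
  next
    case 2
    from side_cos_degenerate[OF assms(2,3,1) 2] show ?thesis
      by (simp add: clamped_arccos_le_minus_1 clamped_arccos_ge_1)
  next
    case 3
    from side_cos_degenerate[OF assms(3,1,2) 3] show ?thesis
      by (simp add: clamped_arccos_le_minus_1 clamped_arccos_ge_1)
  next
    case 4
    then have "\<bar>side_cos p q r\<bar> \<le> 1" "\<bar>side_cos q r p\<bar> \<le> 1" "\<bar>side_cos r p q\<bar> \<le> 1"
      using euclidean_triangle_angle_sum(2)[OF assms 4] euclidean_triangle_angle_sum(2)[OF assms(2,3,1) 4(2,3,1)]
        euclidean_triangle_angle_sum(2)[OF assms(3,1,2) 4(3,1,2)] by simp_all
    then show ?thesis using euclidean_triangle_angle_sum(1)[OF assms 4] by (simp add: clamped_arccos_eq)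
  qed
qed

section \<open>Uniform comparison with the Euclidean limit\<close>

lemma clamp_perturbation:
  fixes c e k :: real
  assumes "1 \<le> k"
  shows "\<bar>max (- 1) (min 1 (k * (c - e))) - max (- 1) (min 1 c)\<bar> \<le> (k - 1) + k * \<bar>e\<bar>"
proof -
  define cl :: "real \<Rightarrow> real" where "cl x = max (- 1) (min 1 x)" for x
  have cl: "x \<le> - 1 \<Longrightarrow> cl x = - 1" "1 \<le> x \<Longrightarrow> cl x = 1" "- 1 \<le> x \<Longrightarrow> x \<le> 1 \<Longrightarrow> cl x = x" for x
    by (auto simp: cl_def)
  have lip: "\<bar>cl x - cl y\<bar> \<le> \<bar>x - y\<bar>" for x y
    unfolding cl_def by (simp split: split_max split_min)
  \<comment> \<open>Although \<open>c\<close> is unbounded, scaling by \<open>k\<close> matters only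
    for \<open>\<bar>c\<bar> \<le> 1\<close>: beyond that range both values clamp to the same
    end.\<close>
  have "\<bar>cl (k * c) - cl c\<bar> \<le> k - 1"
  proof -
    consider "1 \<le> c" | "c \<le> - 1" | "\<bar>c\<bar> \<le> 1" by linarith
    then show ?thesis
    proof cases
      case 1
      then have "1 \<le> k * c" using mult_mono[of 1 k 1 c] assms by simp
      then show ?thesis using 1 assms by (simp add: cl)
    next
      case 2
      then have "k * c \<le> - 1" using mult_mono[of 1 k 1 "- c"] assms by simp
      then show ?thesis using 2 assms by (simp add: cl)
    next
      case 3
      have "k * c - c = (k - 1) * c" by (simp add: algebra_simps)
      then have "\<bar>k * c - c\<bar> = (k - 1) * \<bar>c\<bar>" using assms by (simp add: abs_mult)
      also have "\<dots> \<le> k - 1" using 3 assms mult_left_le[of "\<bar>c\<bar>" "k - 1"] by simp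
      finally show ?thesis using lip[of "k * c" c] by linarith
    qed
  qed
  moreover have "k * (c - e) - k * c = - (k * e)" by (simp add: algebra_simps)
  then have "\<bar>k * (c - e) - k * c\<bar> = k * \<bar>e\<bar>" using assms by (simp add: abs_mult)
  ultimately show ?thesis using lip[of "k * (c - e)" "k * c"] unfolding cl_def[symmetric] by linarith
qed

text \<open>As \<open>a\<close> tends to 1 the link of the vertex shrinks to a Euclidean triangle whose squared side
  lengths are \<open>a + b\<close>, \<open>a + c\<close> and \<open>a + d\<close>; the estimate is uniform in \<open>b\<close>, \<open>c\<close> and \<open>d\<close>.\<close>
lemma edge_cos_near_side_cos:
  assumes ge: "1 \<le> a" "1 \<le> b" "1 \<le> c" "1 \<le> d" and S: "a\<^sup>2 - 1 \<le> 1"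
  shows "\<bar>max (- 1) (min 1 (edge_cos a b c d))
           - max (- 1) (min 1 (side_cos (sqrt (a + b)) (sqrt (a + c)) (sqrt (a + d))))\<bar> \<le> a\<^sup>2 - 1"
proof -
  define S xb xc xd where x: "S = a\<^sup>2 - 1" "xb = a + b" "xc = a + c" "xd = a + d"
  have S01: "0 \<le> S" "S \<le> 1" using ge S by (simp_all add: x)
  have x2: "2 \<le> xb" "2 \<le> xc" "2 \<le> xd" using ge by (simp_all add: x)
  define P R where P: "P = xb * xc - S" and R: "R = xb * xd - S"
  define s q where s: "s = sqrt (xc * xd)" and q: "q = sqrt (P * R)"
  \<comment> \<open>Ratio of the Euclidean to the actual denominator, up to the factor
    \<open>xb\<close>. With \<open>e\<close> below, the edge cosine is
    \<open>k * (side_cos - e)\<close>, where \<open>k\<close> lies between 1 and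
    \<open>1 + S / 2\<close> and \<open>e\<close> is at most \<open>S / 4\<close>.\<close>
  define k where "k = xb * s / q"
  have prod: "4 \<le> xb * xc" "4 \<le> xb * xd" "4 \<le> xc * xd"
    using mult_mono[of 2 xb 2 xc] mult_mono[of 2 xb 2 xd] mult_mono[of 2 xc 2 xd] x2 by auto
  have s2: "2 \<le> s" unfolding s using prod by (intro real_le_rsqrt) simp
  have w4: "4 \<le> xb * s" using mult_mono[of 2 xb 2 s] x2 s2 by simp
  have PR: "0 < P" "0 < R" using prod S01 by (simp_all add: P R)
  then have q0: "0 < q" by (simp add: q)
  have w: "xb * s = sqrt ((xb * xc) * (xb * xd))"
  proof (rule real_sqrt_unique[symmetric])
    show "(xb * s)\<^sup>2 = (xb * xc) * (xb * xd)"
      using x2 by (simp add: s power_mult_distrib) (simp add: power2_eq_square)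
  qed (use w4 in simp)
  have "q \<le> xb * s"
    unfolding q w using PR S01 prod by (intro real_sqrt_le_mono mult_mono) (auto simp: P R)
  \<comment> \<open>The products \<open>xb * xc\<close> and \<open>xb * xd\<close> are at least 4,
    so subtracting \<open>S\<close> costs at most the fraction \<open>S / 4\<close> of
    either.\<close>
  have "(1 - S / 4) * (xb * s) = sqrt (((1 - S / 4) * (xb * xc)) * ((1 - S / 4) * (xb * xd)))"
  proof (rule real_sqrt_unique[symmetric])
    have "(xb * s)\<^sup>2 = (xb * xc) * (xb * xd)" unfolding w using prod by simp
    then show "((1 - S / 4) * (xb * s))\<^sup>2 = ((1 - S / 4) * (xb * xc)) * ((1 - S / 4) * (xb * xd))"
      unfolding power_mult_distrib[of "1 - S / 4"] by (simp add: power2_eq_square)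
    show "0 \<le> (1 - S / 4) * (xb * s)" by (rule mult_nonneg_nonneg) (use S01 w4 in linarith)+
  qed
  also have "\<dots> \<le> q"
    unfolding q
  proof (intro real_sqrt_le_mono mult_mono)
    have "S * 4 \<le> S * (xb * xc)" "S * 4 \<le> S * (xb * xd)" using S01 prod by (auto intro: mult_left_mono)
    then show "(1 - S / 4) * (xb * xc) \<le> P" "(1 - S / 4) * (xb * xd) \<le> R"
      by (simp_all add: P R algebra_simps)
  qed (use PR S01 prod in auto)
  finally have q_ge: "(1 - S / 4) * (xb * s) \<le> q" .
  have k1: "1 \<le> k" using \<open>q \<le> xb * s\<close> q0 by (simp add: k_def)
  have "xb * s \<le> (1 + S / 2) * ((1 - S / 4) * (xb * s))"
  proof -
    have "S * S \<le> S * 1" using S01 by (intro mult_left_mono) auto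
    then have "1 \<le> (1 + S / 2) * (1 - S / 4)" using S01 by (simp add: algebra_simps)
    then have "1 * (xb * s) \<le> ((1 + S / 2) * (1 - S / 4)) * (xb * s)" using w4 by (intro mult_right_mono) auto
    then show ?thesis by (simp add: mult.assoc)
  qed
  also have "\<dots> \<le> (1 + S / 2) * q" using q_ge S01 by (intro mult_left_mono) auto
  finally have k2: "k \<le> 1 + S / 2" using q0 by (simp add: k_def divide_le_eq)
  define e where "e = S / (xb * s)"
  have e0: "0 \<le> e" unfolding e_def using S01 w4 by (intro divide_nonneg_nonneg) linarith+
  have e4: "e \<le> S / 4" unfolding e_def by (rule divide_left_mono) (use S01 w4 in linarith)+
  have side: "side_cos (sqrt (a + b)) (sqrt (a + c)) (sqrt (a + d)) = (xc + xd - xb) / (2 * s)"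
    unfolding side_cos_def x(2-4)[symmetric] using x2 by (simp add: s real_sqrt_mult)
  have "coth_sigma a b c = P" "coth_sigma a b d = R"
    by (simp_all add: coth_sigma_def P R x power2_eq_square algebra_simps)
  then have "edge_cos a b c d = (P + R - xb\<^sup>2) / (2 * q)"
    by (simp add: edge_cos_def x(2) q)
  also have "\<dots> = k * ((xc + xd - xb) / (2 * s) - e)"
  proof -
    have "s \<noteq> 0" "xb \<noteq> 0" using s2 x2 by simp_all
    then have "k * ((xc + xd - xb) / (2 * s)) = xb * (xc + xd - xb) / (2 * q)" "k * e = 2 * S / (2 * q)"
      by (simp_all add: k_def e_def)
    then have "k * ((xc + xd - xb) / (2 * s) - e) = (xb * (xc + xd - xb) - 2 * S) / (2 * q)"
      by (simp only: right_diff_distrib[of k] diff_divide_distrib)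
    moreover have "P + R - xb\<^sup>2 = xb * (xc + xd - xb) - 2 * S"
      by (simp add: P R power2_eq_square algebra_simps)
    ultimately show ?thesis by simp
  qed
  finally have "\<bar>max (- 1) (min 1 (edge_cos a b c d))
           - max (- 1) (min 1 (side_cos (sqrt (a + b)) (sqrt (a + c)) (sqrt (a + d))))\<bar>
      \<le> (k - 1) + k * \<bar>e\<bar>"
    unfolding side using clamp_perturbation[OF k1] by simp
  \<comment> \<open>The two errors are at most \<open>S / 2\<close> and \<open>3 * S / 8\<close>,
    together at most \<open>S\<close>.\<close>
  also have "k * \<bar>e\<bar> \<le> (3 / 2) * (S / 4)"
    using k1 k2 e0 e4 S01 by (intro mult_mono) auto
  finally show ?thesis using k2 S01 unfolding x(1)[symmetric] by linarith
qed

text \<open>Uniform continuity of \<open>arccos\<close> turns closeness of clamped cosines into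
  closeness of angles, even at the ends of the interval. Three errors below \<open>e / 3\<close> are
  added to a Euclidean angle sum of pi.\<close>

lemma coth_solid_angle_small:
  assumes "0 < e"
  obtains \<delta> where "0 < \<delta>"
    "\<And>a b c d. 1 \<le> a \<Longrightarrow> a < 1 + \<delta> \<Longrightarrow> 1 \<le> b \<Longrightarrow> 1 \<le> c \<Longrightarrow> 1 \<le> d \<Longrightarrow> coth_solid_angle a b c d < e"
proof -
  have "uniformly_continuous_on {-1..1} arccos"
    by (intro compact_uniformly_continuous continuous_on_arccos') auto
  then obtain d0 where d0: "0 < d0"
    "\<And>x y. x \<in> {-1..1} \<Longrightarrow> y \<in> {-1..1} \<Longrightarrow> dist x y < d0 \<Longrightarrow> dist (arccos x) (arccos y) < e / 3"
    unfolding uniformly_continuous_on_def using assms by (metis zero_less_divide_iff zero_less_numeral)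
  \<comment> \<open>The 3 absorbs the factor \<open>a + 1\<close> in
    \<open>a\<^sup>2 - 1\<close>.\<close>
  define \<delta> where "\<delta> = min 1 d0 / 3"
  have near: "clamped_arccos (edge_cos a b c d)
      < clamped_arccos (side_cos (sqrt (a + b)) (sqrt (a + c)) (sqrt (a + d))) + e / 3"
    if "1 \<le> a" "a < 1 + \<delta>" "1 \<le> b" "1 \<le> c" "1 \<le> d" for a b c d
  proof -
    have "(a - 1) * (a + 1) \<le> (a - 1) * 3" using that by (intro mult_left_mono) (auto simp: \<delta>_def)
    then have S: "a\<^sup>2 - 1 \<le> 3 * (a - 1)" by (simp add: power2_eq_square algebra_simps)
    have "a\<^sup>2 - 1 \<le> 1" "a\<^sup>2 - 1 < d0" using S that by (auto simp: \<delta>_def)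
    then have "dist (max (- 1) (min 1 (edge_cos a b c d)))
        (max (- 1) (min 1 (side_cos (sqrt (a + b)) (sqrt (a + c)) (sqrt (a + d))))) < d0"
      using edge_cos_near_side_cos[of a b c d] that by (simp add: dist_real_def)
    then have "dist (clamped_arccos (edge_cos a b c d))
        (clamped_arccos (side_cos (sqrt (a + b)) (sqrt (a + c)) (sqrt (a + d)))) < e / 3"
      unfolding clamped_arccos_def by (intro d0(2)) auto
    then show ?thesis unfolding dist_real_def by linarith
  qed
  show thesis
  proof (rule that[of \<delta>])
    fix a b c d :: real
    assume h: "1 \<le> a" "a < 1 + \<delta>" "1 \<le> b" "1 \<le> c" "1 \<le> d"
    show "coth_solid_angle a b c d < e"
      using near[of a b c d] near[of a c d b] near[of a d b c] h
        clamped_arccos_side_cos_sum[of "sqrt (a + b)" "sqrt (a + c)" "sqrt (a + d)"]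
      by (simp add: coth_solid_angle_def)
  qed (use d0 in \<open>simp add: \<delta>_def\<close>)
qed

section \<open>The flow\<close>

text \<open>Inverse of \<open>ln (tanh (r / 2))\<close>, obtained by solving dr / sinh r = dv; this
  removes the factor sinh r from the flow.\<close>

definition radius_of :: "real \<Rightarrow> real" where
  "radius_of v = ln ((1 + exp v) / (1 - exp v))"

lemma radius_of_inverse:
  assumes "0 < r"
  shows "ln (tanh (r / 2)) < 0" "radius_of (ln (tanh (r / 2))) = r"
proof -
  define E where "E = exp r"
  have E: "1 < E" using assms by (simp add: E_def)
  have "tanh (r / 2) = (1 - exp (- r)) / (1 + exp (- r))" by (simp add: tanh_real_altdef)
  then have w: "tanh (r / 2) = (E - 1) / (E + 1)"
    using E by (simp add: exp_minus E_def[symmetric] divide_simps)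
  then have w01: "0 < tanh (r / 2)" "tanh (r / 2) < 1" using E by simp_all
  then show "ln (tanh (r / 2)) < 0" by simp
  have "(1 + tanh (r / 2)) / (1 - tanh (r / 2)) = E" unfolding w using E by (simp add: field_simps)
  then show "radius_of (ln (tanh (r / 2))) = r" using w01 by (simp add: radius_of_def E_def)
qed

lemma
  assumes "v < 0"
  shows radius_of_pos: "0 < radius_of v"
    and sinh_radius_of: "sinh (radius_of v) = 2 * exp v / (1 - (exp v)\<^sup>2)"
    and coth_radius_of: "coth (radius_of v) = cosh v"
    and DERIV_radius_of: "(radius_of has_real_derivative sinh (radius_of v)) (at v)"
proof -
  define w where "w = exp v"
  have w: "0 < w" "w < 1" using assms by (simp_all add: w_def)
  then have "w * w < 1 * 1" by (intro mult_strict_mono) auto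
  then have ww: "w\<^sup>2 < 1" by (simp add: power2_eq_square)
  have sq: "1 - w\<^sup>2 = (1 - w) * (1 + w)" by (simp add: power2_eq_square algebra_simps)
  have E1: "exp (radius_of v) = (1 + w) / (1 - w)"
    using w unfolding radius_of_def w_def[symmetric] by (intro exp_ln) simp
  have E: "exp (radius_of v) = (1 + w) / (1 - w)" "exp (- radius_of v) = (1 - w) / (1 + w)"
    by (simp_all add: E1 exp_minus)
  show "0 < radius_of v" using w by (simp add: radius_of_def w_def[symmetric])
  have s: "sinh (radius_of v) = 2 * w / (1 - w\<^sup>2)"
  proof -
    have num: "(1 + w) * (1 + w) - (1 - w) * (1 - w) = 2 * (2 * w)" by (simp add: algebra_simps)
    have "(1 + w) / (1 - w) - (1 - w) / (1 + w) = 2 * (2 * w) / ((1 - w) * (1 + w))"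
      by (subst diff_frac_eq) (use w num in auto)
    then show ?thesis unfolding sinh_field_def E sq by simp
  qed
  then show "sinh (radius_of v) = 2 * exp v / (1 - (exp v)\<^sup>2)" by (simp add: w_def)
  have c: "cosh (radius_of v) = (1 + w\<^sup>2) / (1 - w\<^sup>2)"
  proof -
    have num: "(1 + w) * (1 + w) + (1 - w) * (1 - w) = 2 * (1 + w\<^sup>2)"
      by (simp add: power2_eq_square algebra_simps)
    have "(1 + w) / (1 - w) + (1 - w) / (1 + w) = 2 * (1 + w\<^sup>2) / ((1 - w) * (1 + w))"
      by (subst add_frac_eq) (use w num in auto)
    then show ?thesis unfolding cosh_field_def E sq by (simp del: distrib_left_numeral)
  qed
  have "coth (radius_of v) = (1 + w\<^sup>2) / (2 * w)"
    using w ww by (simp add: coth_def s c)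
  also have "\<dots> = cosh v"
    using w by (simp add: cosh_field_def w_def exp_minus field_simps power2_eq_square)
  finally show "coth (radius_of v) = cosh v" .
  have "((\<lambda>x. ln (1 + exp x) - ln (1 - exp x)) has_real_derivative w / (1 + w) + w / (1 - w)) (at v)"
    using w by (auto intro!: derivative_eq_intros add_pos_pos simp: w_def)
  moreover have "w / (1 + w) + w / (1 - w) = sinh (radius_of v)"
    unfolding s sq using w by (simp add: field_simps)
  ultimately have "((\<lambda>x. ln (1 + exp x) - ln (1 - exp x)) has_real_derivative sinh (radius_of v)) (at v)" by simp
  then show "(radius_of has_real_derivative sinh (radius_of v)) (at v)"
  proof (rule has_field_derivative_transform_within_open)
    show "open {..<0::real}" "v \<in> {..<0}" using assms by auto
    fix x :: real assume "x \<in> {..<0}"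
    moreover have "0 < 1 + exp x" by (simp add: add_pos_pos)
    ultimately show "ln (1 + exp x) - ln (1 - exp x) = radius_of x"
      by (simp add: radius_of_def ln_div)
  qed
qed

section \<open>Barrier argument and global existence\<close>

lemma upper_barrier:
  fixes f f' :: "real \<Rightarrow> real"
  assumes deriv: "\<And>t. 0 \<le> t \<Longrightarrow> (f has_real_derivative f' t) (at t within {0..})"
    and init: "f 0 \<le> u" and down: "\<And>t. 0 \<le> t \<Longrightarrow> u \<le> f t \<Longrightarrow> f' t \<le> 0"
    and t: "0 \<le> t"
  shows "f t \<le> u"
proof (rule ccontr)
  assume "\<not> f t \<le> u"
  have "continuous_on {0..} f"
    using deriv by (meson DERIV_continuous_on atLeast_iff)
  then have cont: "continuous_on {0..t} f" by (rule continuous_on_subset) auto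
  define A where "A = {s \<in> {0..t}. f s \<le> u}"
  have "closed A" unfolding A_def
    by (rule continuous_on_closed_Collect_le[OF cont]) auto
  moreover have "A \<noteq> {}" using init t by (auto simp: A_def)
  moreover have bdd: "bdd_above A" unfolding A_def by (intro bdd_aboveI[of _ t]) auto
  ultimately have "Sup A \<in> A" using closed_contains_Sup by blast
  \<comment> \<open>The last time in \<open>{0..t}\<close> at which \<open>f\<close> is at most
    \<open>u\<close>. Afterwards \<open>f\<close> stays above \<open>u\<close>, where the derivative
    is nonpositive, so it cannot rise.\<close>
  define s where "s = Sup A"
  have s: "0 \<le> s" "s \<le> t" "f s \<le> u" using \<open>Sup A \<in> A\<close> by (auto simp: A_def s_def)
  have above: "u < f x" if "s < x" "x \<le> t" for x
  proof (rule ccontr)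
    assume "\<not> u < f x"
    then have "x \<in> A" using that s by (simp add: A_def)
    then have "x \<le> s" unfolding s_def using bdd by (rule cSup_upper)
    with that show False by simp
  qed
  have "f t \<le> f s"
  proof (rule DERIV_nonpos_imp_decreasing_open[OF \<open>s \<le> t\<close>])
    fix x assume x: "s < x" "x < t"
    then have "at x within {0..} = at x" using s by (intro at_within_interior) simp
    then have "DERIV f x :> f' x" using deriv[of x] x s by simp
    moreover have "f' x \<le> 0" using down[of x] above[of x] x s by simp
    ultimately show "\<exists>y. DERIV f x :> y \<and> y \<le> 0" by blast
  next
    show "continuous_on {s..t} f" using cont by (rule continuous_on_subset) (use s in auto)
  qed
  with s \<open>\<not> f t \<le> u\<close> show False by simp
qed

theorem theorem3p7:
  fixes M :: "'a topology" and T :: "nat set set" and N :: nat and r0 :: "nat \<Rightarrow> real"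
  assumes "triangulated_closed_3_manifold M T N"
    and "\<forall>i\<in>{1..N}. 0 < r0 i"
  shows "\<exists>r :: real \<Rightarrow> nat \<Rightarrow> real.
           (\<forall>i\<in>{1..N}. r 0 i = r0 i) \<and>
           (\<forall>t\<ge>0. \<forall>i\<in>{1..N}.
              0 < r t i \<and>
              ((\<lambda>s. r s i) has_real_derivative - ext_scalar_curvature T (r t) i * sinh (r t i))
                (at t within {0..}))"
proof -
  define tets where "tets i = {(j, k, l). j < k \<and> k < l \<and> {i, j, k, l} \<in> simplices T 3}" for i
  have "\<Union>T = {1..N}" using assms(1) by (simp add: triangulated_closed_3_manifold_def)
  then have tets_vertices: "j \<in> {1..N}" "k \<in> {1..N}" "l \<in> {1..N}" if "(j, k, l) \<in> tets i" for i j k l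
    using that by (auto simp: tets_def simplices_def)
  \<comment> \<open>Bounds the number of tetrahedra at each vertex, so that one threshold serves all
    vertices.\<close>
  define m where "m = (\<Sum>i\<in>{1..N}. card (tets i))"
  have card_le: "card (tets i) \<le> m" if "i \<in> {1..N}" for i
    unfolding m_def using that by (intro member_le_sum) auto
  have "0 < 4 * pi / (real m + 1)" by simp
  then obtain \<delta> where \<delta>: "0 < \<delta>"
    "\<And>a b c d. 1 \<le> a \<Longrightarrow> a < 1 + \<delta> \<Longrightarrow> 1 \<le> b \<Longrightarrow> 1 \<le> c \<Longrightarrow> 1 \<le> d
       \<Longrightarrow> coth_solid_angle a b c d < 4 * pi / (real m + 1)"
    using coth_solid_angle_small by metis
  have "(cosh \<longlongrightarrow> cosh 0) (at (0::real))" by (intro isContD continuous_intros)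
  then have "eventually (\<lambda>v::real. cosh v < 1 + \<delta>) (at 0)"
    using order_tendstoD(2)[of cosh "cosh 0" "at (0::real)" "1 + \<delta>"] \<delta>(1) by simp
  then obtain \<eta> where \<eta>: "0 < \<eta>" "\<And>v::real. v \<noteq> 0 \<Longrightarrow> \<bar>v\<bar> < \<eta> \<Longrightarrow> cosh v < 1 + \<delta>"
    unfolding eventually_at by (auto simp: dist_real_def)
  define v0 where "v0 i = ln (tanh (r0 i / 2))" for i
  have v0: "v0 i < 0" "radius_of (v0 i) = r0 i" if "i \<in> {1..N}" for i
    using radius_of_inverse assms(2) that by (auto simp: v0_def)
  \<comment> \<open>The truncation level: above all initial values, negative, and close enough to 0
    that \<open>cosh u < 1 + \<delta>\<close>.\<close>
  define u where "u = Max (insert (- \<eta> / 2) (v0 ` {1..N}))"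
  have u_ge: "- \<eta> / 2 \<le> u" unfolding u_def by (rule Max_ge) auto
  have v0_le: "v0 i \<le> u" if "i \<in> {1..N}" for i unfolding u_def by (rule Max_ge) (use that in auto)
  have "u < 0" unfolding u_def using v0 \<eta> by (subst Max_less_iff) auto
  have cosh_u: "cosh u < 1 + \<delta>" using \<open>u < 0\<close> u_ge \<eta> by (intro \<eta>(2)) auto

  define y where "y v j = cosh (min (v j) u)" for v :: "nat \<Rightarrow> real" and j
  have y1: "1 \<le> y v j" for v j by (simp add: y_def cosh_real_ge_1)
  have y0: "0 < y v j" for v j using y1[of v j] by linarith
  \<comment> \<open>Peano's theorem runs over all naturals; coordinates that are not vertices are
    frozen.\<close>
  define F where "F v i = (if i \<in> {1..N}
      then (\<Sum>(j, k, l)\<in>tets i. coth_solid_angle (y v i) (y v j) (y v k) (y v l)) - 4 * pi else 0)"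
    for v :: "nat \<Rightarrow> real" and i
  have cont_y: "continuous_on UNIV (\<lambda>v. y v j)" for j
    unfolding y_def by (intro continuous_intros continuous_on_product_coordinates)
  have contF: "continuous_on UNIV (\<lambda>v. F v i)" for i
    unfolding F_def case_prod_beta
    by (cases "i \<in> {1..N}") (auto intro!: continuous_intros cont_y y0)
  have boundF: "\<bar>F v i\<bar> \<le> real (card (tets i)) * (2 * pi) + 4 * pi" for v i
  proof -
    have "\<bar>\<Sum>(j, k, l)\<in>tets i. coth_solid_angle (y v i) (y v j) (y v k) (y v l)\<bar>
        \<le> (\<Sum>p\<in>tets i. \<bar>case p of (j, k, l) \<Rightarrow> coth_solid_angle (y v i) (y v j) (y v k) (y v l)\<bar>)"
      by (rule sum_abs)
    also have "\<dots> \<le> real (card (tets i)) * (2 * pi)"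
      by (rule sum_bounded_above) (auto simp: coth_solid_angle_bounds)
    finally have "\<bar>(\<Sum>(j, k, l)\<in>tets i. coth_solid_angle (y v i) (y v j) (y v k) (y v l)) - 4 * pi\<bar>
        \<le> real (card (tets i)) * (2 * pi) + 4 * pi"
      using pi_ge_zero by linarith
    then show ?thesis by (simp add: F_def)
  qed
  \<comment> \<open>Truncation gives \<open>y v i = cosh u\<close>, so each of at most
    \<open>m\<close> solid angles is below \<open>4 * pi / (real m + 1)\<close> and their sum cannot
    exceed \<open>4 * pi\<close>.\<close>
  have downF: "F v i \<le> 0" if "u \<le> v i" for v i
  proof (cases "i \<in> {1..N}")
    case True
    have "y v i < 1 + \<delta>" using that cosh_u by (simp add: y_def min_def)
    then have "(\<Sum>(j, k, l)\<in>tets i. coth_solid_angle (y v i) (y v j) (y v k) (y v l))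
        \<le> real (card (tets i)) * (4 * pi / (real m + 1))"
      by (intro sum_bounded_above) (auto intro!: less_imp_le \<delta>(2) y1)
    also have "\<dots> \<le> (real m + 1) * (4 * pi / (real m + 1))"
      using card_le[OF True] by (intro mult_right_mono) auto
    also have "\<dots> = 4 * pi" by simp
    finally show ?thesis by (simp add: F_def)
  next
    case False then show ?thesis by (auto simp: F_def)
  qed
  obtain x where x0: "x 0 = v0"
    and x: "\<And>t i. 0 \<le> t \<Longrightarrow> ((\<lambda>s. x s i) has_real_derivative F (x t) i) (at t within {0..})"
    using peano_existence[of F, OF contF boundF] by blast
  have x_le: "x t i \<le> u" if "0 \<le> t" "i \<in> {1..N}" for t i
    by (rule upper_barrier[OF x]) (use that x0 v0_le downF in auto)
  have x_neg: "x t i < 0" if "0 \<le> t" "i \<in> {1..N}" for t i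
    using x_le[OF that] \<open>u < 0\<close> by simp
  define r where "r t i = radius_of (x t i)" for t i
  \<comment> \<open>The barrier keeps every vertex coordinate at or below \<open>u\<close>, so
    truncation never takes effect along the solution and \<open>F\<close> is the true right-hand
    side.\<close>
  have F_eq: "F (x t) i = - ext_scalar_curvature T (r t) i" if "0 \<le> t" "i \<in> {1..N}" for t i
  proof -
    have y_eq: "0 < r t j" "coth (r t j) = y (x t) j" if "j \<in> {1..N}" for j
      using x_le[OF \<open>0 \<le> t\<close> that] x_neg[OF \<open>0 \<le> t\<close> that]
      by (simp_all add: r_def radius_of_pos coth_radius_of y_def)
    have "(\<Sum>(j, k, l)\<in>tets i. ext_solid_angle (r t i) (r t j) (r t k) (r t l))
        = (\<Sum>(j, k, l)\<in>tets i. coth_solid_angle (y (x t) i) (y (x t) j) (y (x t) k) (y (x t) l))"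
    proof (rule sum.cong)
      fix p assume p: "p \<in> tets i"
      obtain j k l where jkl: "p = (j, k, l)" by (cases p)
      then have "j \<in> {1..N}" "k \<in> {1..N}" "l \<in> {1..N}" using p tets_vertices by blast+
      then show "(case p of (j, k, l) \<Rightarrow> ext_solid_angle (r t i) (r t j) (r t k) (r t l))
          = (case p of (j, k, l) \<Rightarrow> coth_solid_angle (y (x t) i) (y (x t) j) (y (x t) k) (y (x t) l))"
        using y_eq that by (simp add: jkl ext_solid_angle_eq del: atLeastAtMost_iff)
    qed simp
    then show ?thesis using that by (simp add: F_def ext_scalar_curvature_def tets_def[symmetric])
  qed
  have "0 < r t i \<and> ((\<lambda>s. r s i) has_real_derivative - ext_scalar_curvature T (r t) i * sinh (r t i)) (at t within {0..})"
    if "0 \<le> t" "i \<in> {1..N}" for t i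
    using DERIV_chain2[OF DERIV_radius_of[OF x_neg[OF that]] x[OF that(1), of i]] radius_of_pos[OF x_neg[OF that]]
    unfolding F_eq[OF that] r_def by (simp add: mult.commute)
  moreover have "r 0 i = r0 i" if "i \<in> {1..N}" for i using v0(2)[OF that] by (simp add: r_def x0)
  ultimately show ?thesis by (intro exI[of _ r]) blast
qed

end
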